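(* Let $q\ge 2$ be an integer. For any $f\in L^\infty(\mathbb{T})$, the spectrum of $\Gamma_q[f]$ on $\ell^2(T_q)$ coincides with the spectrum of the standard Toeplitz operator $T(f)=\Gamma_1[f]$ on $\ell^2(\mathbb{N})$: $$\mathrm{spec}(\Gamma_q[f])=\mathrm{spec}(\Gamma_1[f])=\mathrm{spec}(T(f)).$$
   Context: $T_q$ denotes the (vertex set of the) infinite rooted $q$-homogeneous tree: there is a root $o$, and each vertex has exactly $q$ children. $d$ is the graph distance and $|\sigma| := d(o,\sigma)$. Write $\sigma_1\preccurlyeq\sigma_2$ if $\sigma_1,\sigma_2$ lie on a common geodesic ray starting at the root and $|\sigma_1|\le|\sigma_2|$. Let $\mathcal{C}\subset T_q\times T_q$ be the set of comparable pairs ($\sigma_1\preccurlyeq\sigma_2$ or $\sigma_2\preccurlyeq\sigma_1$), with indicator function $\mathbf{1}_{\mathcal{C}}$. $\mathbb{T}=\mathbb{R}/2\pi\mathbb{Z}$, $\mathbb{N}=\{0,1,2,\dots\}$. For $f\in L^\infty(\mathbb{T})$, $\widehat f(n)=\int_{\mathbb{T}} f(e^{i\theta})e^{-in\theta}\frac{d\theta}{2\pi}$, and $$\Gamma_q[f](\sigma_1,\sigma_2) := q^{-d(\sigma_1,\sigma_2)/2}\,\widehat f(|\sigma_1|-|\sigma_2|)\,\mathbf{1}_{\mathcal{C}}(\sigma_1,\sigma_2).$$ Bounded operators $A$ on $\ell^2(T_q)$ are identified with their kernels $A(\sigma_1,\sigma_2)=\langle A\delta_{\sigma_2},\delta_{\sigma_1}\rangle$;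 for every $f\in L^\infty(\mathbb{T})$ the kernel $\Gamma_q[f]$ represents a bounded operator on $\ell^2(T_q)$. $T(f)=\Gamma_1[f]$ is the bounded operator on $\ell^2(\mathbb{N})$ with matrix $[\widehat f(k-l)]_{k,l\in\mathbb{N}}$. *)

theory Defs
  imports "HOL-Analysis.Analysis"
begin

section \<open>Operators on \<open>\<ell>\<^sup>2(X)\<close>\<close>

text \<open>Vectors of \<open>\<ell>\<^sup>2(X)\<close> are represented by their extension by zero outside \<open>X\<close>.\<close>

definition ell2 :: "'a set \<Rightarrow> ('a \<Rightarrow> complex) set" where
  "ell2 X = {x. (\<forall>i. i \<notin> X \<longrightarrow> x i = 0) \<and> (\<lambda>i. (cmod (x i))\<^sup>2) summable_on X}"

definition ell2_norm :: "'a set \<Rightarrow> ('a \<Rightarrow> complex) \<Rightarrow> real" where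
  "ell2_norm X x = sqrt (\<Sum>\<^sub>\<infinity>i\<in>X. (cmod (x i))\<^sup>2)"

definition ell2_inner :: "'a set \<Rightarrow> ('a \<Rightarrow> complex) \<Rightarrow> ('a \<Rightarrow> complex) \<Rightarrow> complex" where
  "ell2_inner X x y = (\<Sum>\<^sub>\<infinity>i\<in>X. x i * cnj (y i))"

definition delta :: "'a \<Rightarrow> 'a \<Rightarrow> complex" where
  "delta j = (\<lambda>i. if i = j then 1 else 0)"

definition bounded_op :: "'a set \<Rightarrow> (('a \<Rightarrow> complex) \<Rightarrow> ('a \<Rightarrow> complex)) \<Rightarrow> bool" where
  "bounded_op X A \<longleftrightarrow>
     (\<forall>x\<in>ell2 X. A x \<in> ell2 X) \<and>
     (\<forall>x\<in>ell2 X. \<forall>y\<in>ell2 X. A (\<lambda>i. x i + y i) = (\<lambda>i. A x i + A y i)) \<and>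
     (\<forall>c. \<forall>x\<in>ell2 X. A (\<lambda>i. c * x i) = (\<lambda>i. c * A x i)) \<and>
     (\<exists>C. \<forall>x\<in>ell2 X. ell2_norm X (A x) \<le> C * ell2_norm X x)"

definition spec :: "'a set \<Rightarrow> (('a \<Rightarrow> complex) \<Rightarrow> ('a \<Rightarrow> complex)) \<Rightarrow> complex set" where
  "spec X A = {z. \<not> (\<exists>B. bounded_op X B \<and>
     (\<forall>x\<in>ell2 X. B (\<lambda>i. A x i - z * x i) = x \<and>
                 (\<lambda>i. A (B x) i - z * B x i) = x))}"

text \<open>
  The operator with kernel \<open>K\<close>. The lemma \<open>bounded_op_eq_kernel_op\<close> below shows that a bounded
  operator \<open>A\<close> is recovered in this way from its kernel
  \<open>K i j = \<langle>A \<delta>\<^sub>j, \<delta>\<^sub>i\<rangle>\<close>.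
\<close>

definition kernel_op :: "'a set \<Rightarrow> ('a \<Rightarrow> 'a \<Rightarrow> complex) \<Rightarrow> ('a \<Rightarrow> complex) \<Rightarrow> ('a \<Rightarrow> complex)" where
  "kernel_op X K x = (\<lambda>i. if i \<in> X then \<Sum>\<^sub>\<infinity>j\<in>X. K i j * x j else 0)"

lemma ell2_finite_support:
  assumes "finite F" "F \<subseteq> X" "\<And>i. i \<notin> F \<Longrightarrow> x i = 0"
  shows "x \<in> ell2 X"
proof -
  have "(\<lambda>i. (cmod (x i))\<^sup>2) summable_on F" using assms(1) by simp
  then have "(\<lambda>i. (cmod (x i))\<^sup>2) summable_on X"
    by (rule summable_on_cong_neutral[THEN iffD1, rotated -1]) (use assms in auto)
  then show ?thesis using assms by (auto simp: ell2_def)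
qed

lemma delta_in_ell2: "j \<in> X \<Longrightarrow> delta j \<in> ell2 X"
  by (rule ell2_finite_support[of "{j}"]) (auto simp: delta_def)

lemma ell2_inner_delta:
  assumes "i \<in> X"
  shows "ell2_inner X y (delta i) = y i"
proof -
  have "ell2_inner X y (delta i) = (\<Sum>\<^sub>\<infinity>k\<in>{i}. y k)"
    unfolding ell2_inner_def
    by (rule infsum_cong_neutral) (use assms in \<open>auto simp: delta_def\<close>)
  then show ?thesis by simp
qed

lemma cmod_le_ell2_norm:
  assumes "x \<in> ell2 X" "i \<in> X"
  shows "cmod (x i) \<le> ell2_norm X x"
proof -
  have "(\<Sum>k\<in>{i}. (cmod (x k))\<^sup>2) \<le> (\<Sum>\<^sub>\<infinity>k\<in>X. (cmod (x k))\<^sup>2)"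
    by (rule finite_sum_le_infsum) (use assms in \<open>auto simp: ell2_def\<close>)
  then show ?thesis unfolding ell2_norm_def by (simp add: real_le_rsqrt)
qed

lemma bounded_op_add:
  "bounded_op X A \<Longrightarrow> x \<in> ell2 X \<Longrightarrow> y \<in> ell2 X \<Longrightarrow> A (\<lambda>i. x i + y i) = (\<lambda>i. A x i + A y i)"
  by (simp add: bounded_op_def)

lemma bounded_op_scale:
  "bounded_op X A \<Longrightarrow> x \<in> ell2 X \<Longrightarrow> A (\<lambda>i. c * x i) = (\<lambda>i. c * A x i)"
  by (simp add: bounded_op_def)

lemma bounded_op_finite_support:
  assumes A: "bounded_op X A" and "finite F" "F \<subseteq> X"
  shows "A (\<lambda>k. if k \<in> F then x k else 0) = (\<lambda>i. \<Sum>j\<in>F. A (delta j) i * x j)"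
  using assms(2,3)
proof (induction F rule: finite_induct)
  case empty
  have "(\<lambda>_. 0) \<in> ell2 X" by (rule ell2_finite_support[of "{}"]) auto
  from bounded_op_scale[OF A this, of 0] show ?case by simp
next
  case (insert j F)
  let ?y = "\<lambda>k. if k \<in> F then x k else 0"
  have y: "?y \<in> ell2 X"
    by (rule ell2_finite_support[of F]) (use insert in auto)
  have d: "delta j \<in> ell2 X" using insert by (intro delta_in_ell2) auto
  have d': "(\<lambda>k. x j * delta j k) \<in> ell2 X"
    by (rule ell2_finite_support[of "{j}"]) (use insert in \<open>auto simp: delta_def\<close>)
  have split: "(\<lambda>k. if k \<in> insert j F then x k else 0) = (\<lambda>k. x j * delta j k + ?y k)"
    using insert.hyps by (auto simp: delta_def)
  have IH: "A ?y = (\<lambda>i. \<Sum>j\<in>F. A (delta j) i * x j)"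
    using insert by auto
  show ?case
    unfolding split bounded_op_add[OF A d' y] bounded_op_scale[OF A d] IH
    using insert.hyps by (simp add: mult.commute)
qed

lemma bounded_op_eq_kernel_op:
  assumes A: "bounded_op X A" and x: "x \<in> ell2 X"
  shows "A x = kernel_op X (\<lambda>i j. ell2_inner X (A (delta j)) (delta i)) x"
proof
  fix i
  show "A x i = kernel_op X (\<lambda>i j. ell2_inner X (A (delta j)) (delta i)) x i"
  proof (cases "i \<in> X")
    case False
    then show ?thesis using A x by (auto simp: bounded_op_def ell2_def kernel_op_def)
  next
    case i: True
    obtain C where C: "\<And>y. y \<in> ell2 X \<Longrightarrow> ell2_norm X (A y) \<le> C * ell2_norm X y"
      using A unfolding bounded_op_def by blast
    let ?n = "\<lambda>k. (cmod (x k))\<^sup>2"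
    have sx: "?n summable_on X" using x by (simp add: ell2_def)
    have bound: "cmod ((\<Sum>j\<in>F. A (delta j) i * x j) - A x i)
        \<le> C * sqrt (infsum ?n X - sum ?n F)" if F: "finite F" "F \<subseteq> X" for F
    proof -
      let ?y = "\<lambda>k. if k \<in> F then x k else 0"
      let ?r = "\<lambda>k. if k \<in> F then 0 else x k"
      have hs: "((\<lambda>k. (cmod (?r k))\<^sup>2) has_sum (infsum ?n X - sum ?n F)) X"
      proof -
        have "(?n has_sum (infsum ?n X - sum ?n F)) (X - F)"
          using F sx by (intro has_sum_Diff) auto
        then show ?thesis
          by (rule has_sum_cong_neutral[THEN iffD1, rotated -1]) (use F in auto)
      qed
      have r: "?r \<in> ell2 X"
        using x has_sum_imp_summable[OF hs] by (auto simp: ell2_def)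
      have y: "?y \<in> ell2 X"
        by (rule ell2_finite_support[of F]) (use F in auto)
      have "x = (\<lambda>k. ?y k + ?r k)" by auto
      then have "A x = (\<lambda>k. A ?y k + A ?r k)"
        using bounded_op_add[OF A y r] by simp
      then have "A x i = (\<Sum>j\<in>F. A (delta j) i * x j) + A ?r i"
        using bounded_op_finite_support[OF A F, of x] by metis
      then have "cmod ((\<Sum>j\<in>F. A (delta j) i * x j) - A x i) = cmod (A ?r i)"
        by (simp add: norm_minus_commute)
      also have "\<dots> \<le> ell2_norm X (A ?r)"
        using A r i by (intro cmod_le_ell2_norm) (auto simp: bounded_op_def)
      also have "\<dots> \<le> C * ell2_norm X ?r" using C r by blast
      also have "ell2_norm X ?r = sqrt (infsum ?n X - sum ?n F)"
        unfolding ell2_norm_def using infsumI[OF hs] by simp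
      finally show ?thesis .
    qed
    have "((\<lambda>F. C * sqrt (infsum ?n X - sum ?n F)) \<longlongrightarrow> C * sqrt (infsum ?n X - infsum ?n X))
        (finite_subsets_at_top X)"
      by (intro tendsto_intros infsum_tendsto sx)
    then have lim: "((\<lambda>F. C * sqrt (infsum ?n X - sum ?n F)) \<longlongrightarrow> 0) (finite_subsets_at_top X)"
      by simp
    have "((\<lambda>F. (\<Sum>j\<in>F. A (delta j) i * x j) - A x i) \<longlongrightarrow> 0) (finite_subsets_at_top X)"
      by (rule Lim_null_comparison[OF _ lim])
         (auto intro!: eventually_finite_subsets_at_top_weakI bound)
    then have "((\<lambda>j. A (delta j) i * x j) has_sum A x i) X"
      unfolding has_sum_def by (simp add: LIM_zero_iff)
    then show ?thesis
      using i by (simp add: kernel_op_def ell2_inner_delta infsumI)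
  qed
qed

section \<open>The homogeneous tree\<close>

text \<open>
  A vertex of the rooted \<open>q\<close>-homogeneous tree is the word of child labels read along the path from
  the root \<open>[]\<close>; the children of \<open>u\<close> are the \<open>q\<close> words \<open>u @ [a]\<close> with \<open>a < q\<close>.
\<close>

definition tree :: "nat \<Rightarrow> nat list set" where
  "tree q = lists {..<q}"

definition tree_edges :: "nat \<Rightarrow> (nat list \<times> nat list) set" where
  "tree_edges q = {(u, v). u \<in> tree q \<and> v \<in> tree q \<and> ((\<exists>a. v = u @ [a]) \<or> (\<exists>a. u = v @ [a]))}"

definition tree_dist :: "nat \<Rightarrow> nat list \<Rightarrow> nat list \<Rightarrow> nat" where
  "tree_dist q u v = (LEAST n. (u, v) \<in> tree_edges q ^^ n)"

definition level :: "nat \<Rightarrow> nat list \<Rightarrow> nat" where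
  "level q u = tree_dist q [] u"

definition rooted_geodesic_ray :: "nat \<Rightarrow> (nat \<Rightarrow> nat list) \<Rightarrow> bool" where
  "rooted_geodesic_ray q \<gamma> \<longleftrightarrow>
     \<gamma> 0 = [] \<and> range \<gamma> \<subseteq> tree q \<and>
     (\<forall>m n. int (tree_dist q (\<gamma> m) (\<gamma> n)) = \<bar>int m - int n\<bar>)"

definition tree_le :: "nat \<Rightarrow> nat list \<Rightarrow> nat list \<Rightarrow> bool" where
  "tree_le q u v \<longleftrightarrow>
     (\<exists>\<gamma>. rooted_geodesic_ray q \<gamma> \<and> u \<in> range \<gamma> \<and> v \<in> range \<gamma>) \<and> level q u \<le> level q v"

definition comparable_pairs :: "nat \<Rightarrow> (nat list \<times> nat list) set" where
  "comparable_pairs q = {(u, v). u \<in> tree q \<and> v \<in> tree q \<and> (tree_le q u v \<or> tree_le q v u)}"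

section \<open>Symbols and kernels\<close>

text \<open>
  A function on the circle is given as \<open>f :: complex \<Rightarrow> complex\<close>, of which only the values
  \<open>f (cis \<theta>)\<close> matter, with Lebesgue measure on the period \<open>{0..2*pi}\<close>. Elements of
  \<open>L\<^sup>\<infinity>\<close> are represented by functions rather than by classes of almost everywhere equal functions.
\<close>

definition Linf_circle :: "(complex \<Rightarrow> complex) set" where
  "Linf_circle = {f. (\<lambda>\<theta>. f (cis \<theta>)) \<in> borel_measurable (lebesgue_on {0..2*pi}) \<and>
     (\<exists>C. AE \<theta> in lebesgue_on {0..2*pi}. cmod (f (cis \<theta>)) \<le> C)}"

definition fourier_coeff :: "(complex \<Rightarrow> complex) \<Rightarrow> int \<Rightarrow> complex" where
  "fourier_coeff f n =
     (LINT \<theta>|lebesgue_on {0..2*pi}. f (cis \<theta>) * cis (- (of_int n * \<theta>))) / of_real (2 * pi)"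

definition Gamma_kernel :: "nat \<Rightarrow> (complex \<Rightarrow> complex) \<Rightarrow> nat list \<Rightarrow> nat list \<Rightarrow> complex" where
  "Gamma_kernel q f u v =
     of_real (real q powr (- real (tree_dist q u v) / 2)) *
     fourier_coeff f (int (level q u) - int (level q v)) *
     indicator (comparable_pairs q) (u, v)"

definition Gamma_op ::
  "nat \<Rightarrow> (complex \<Rightarrow> complex) \<Rightarrow> (nat list \<Rightarrow> complex) \<Rightarrow> (nat list \<Rightarrow> complex)" where
  "Gamma_op q f = kernel_op (tree q) (Gamma_kernel q f)"

definition Toeplitz_op :: "(complex \<Rightarrow> complex) \<Rightarrow> (nat \<Rightarrow> complex) \<Rightarrow> (nat \<Rightarrow> complex)" where
  "Toeplitz_op f = kernel_op UNIV (\<lambda>k l. fourier_coeff f (int k - int l))"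

end

theory Submission
  imports Defs "HOL-Library.Sublist"
begin

text \<open>
  Let \<open>S\<close> be the isometry of \<open>\<ell>\<^sup>2(T\<^sub>q)\<close> that spreads the value at a vertex evenly over its
  children, \<open>(S x)(u @ [a]) = q\<^sup>-\<^sup>1\<^sup>/\<^sup>2 x u\<close>.  The kernel of \<open>\<Gamma>\<^sub>q[f]\<close> is that of the formal sum of
  \<open>f^(n) S\<^sup>n\<close> over \<open>n \<ge> 0\<close> and \<open>f^(-n) (S\<^sup>*)\<^sup>n\<close> over \<open>n > 0\<close>, where \<open>f^\<close> are the Fourier coefficients:
  it is the Toeplitz operator with symbol \<open>f\<close> built on \<open>S\<close> instead of the shift of \<open>\<ell>\<^sup>2(\<nat>)\<close>.
  Since \<open>S\<close> raises levels, it has no unitary part, and the Wold decomposition makes it a direct sum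
  of copies of the shift, one for each element of an orthonormal basis of the wandering space
  \<open>ker S\<^sup>*\<close>.  Hence \<open>\<Gamma>\<^sub>q[f]\<close> is unitarily equivalent to a direct sum of copies of \<open>T(f)\<close>, and such a
  sum has the same spectrum as \<open>T(f)\<close> because the copies are inverted simultaneously.  For \<open>q = 1\<close>
  there is a single copy, so this one argument gives both equalities.

  The Wold decomposition is made explicit by a Haar-like basis of \<open>\<ell>\<^sup>2(T\<^sub>q)\<close>.  The space \<open>ker S\<^sup>*\<close>
  consists of the functions that sum to zero over the children of every vertex; characters of
  \<open>\<int>/q\<close> on the children of a vertex, together with the delta at the root, form an
  orthonormal basis.  Applying powers of \<open>S\<close> yields an orthonormal basis of \<open>\<ell>\<^sup>2(T\<^sub>q)\<close> that is finite
  on each level and is indexed by words again: the zeros at the leaf end of the word count the power of \<open>S\<close>.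
  Its orthonormality (\<open>haar_rows_orthonormal\<close>, \<open>haar_columns_orthonormal\<close>) is an induction on words.

  Three facts then carry the theorem.  \<open>bounded_map_Toeplitz_op\<close> bounds \<open>T(f)\<close> by means of Bessel's
  inequality on the circle.  \<open>Gamma_op_eq_wold_conjugate\<close> conjugates the direct sum of copies of
  \<open>T(f)\<close> back to the tree and finds \<open>\<Gamma>\<^sub>q[f]\<close>; this needs only a comparison of kernels, as a bounded
  operator is determined by its kernel, and in particular it gives the boundedness of \<open>\<Gamma>\<^sub>q[f]\<close>.
  \<open>spec_ampliation\<close> and \<open>spec_subset_retract\<close> transport the spectrum.
\<close>

section \<open>Bounded linear maps between \<open>\<ell>\<^sup>2\<close> spaces\<close>

lemma ell2_zero_outside: "x \<in> ell2 X \<Longrightarrow> i \<notin> X \<Longrightarrow> x i = 0"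
  by (simp add: ell2_def)

lemma sum_le_ell2_norm:
  assumes "x \<in> ell2 X" "finite F" "F \<subseteq> X"
  shows "(\<Sum>i\<in>F. (cmod (x i))\<^sup>2) \<le> (ell2_norm X x)\<^sup>2"
proof -
  have "(\<Sum>i\<in>F. (cmod (x i))\<^sup>2) \<le> (\<Sum>\<^sub>\<infinity>i\<in>X. (cmod (x i))\<^sup>2)"
    by (rule finite_sum_le_infsum) (use assms in \<open>auto simp: ell2_def\<close>)
  then show ?thesis unfolding ell2_norm_def by (simp add: infsum_nonneg)
qed

lemma ell2_norm_nonneg: "0 \<le> ell2_norm X x"
  unfolding ell2_norm_def by (simp add: infsum_nonneg)

lemma ell2_norm_bound:
  assumes "\<And>i. i \<notin> X \<Longrightarrow> x i = 0" "0 \<le> M"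
    and "\<And>F. finite F \<Longrightarrow> F \<subseteq> X \<Longrightarrow> (\<Sum>i\<in>F. (cmod (x i))\<^sup>2) \<le> M\<^sup>2"
  shows "x \<in> ell2 X" "ell2_norm X x \<le> M"
proof -
  have s: "(\<lambda>i. (cmod (x i))\<^sup>2) summable_on X"
    by (rule nonneg_bdd_above_summable_on) (use assms(3) in \<open>auto intro!: bdd_aboveI[of _ "M\<^sup>2"]\<close>)
  then show "x \<in> ell2 X" using assms(1) by (simp add: ell2_def)
  have "(\<Sum>\<^sub>\<infinity>i\<in>X. (cmod (x i))\<^sup>2) \<le> M\<^sup>2"
    by (rule infsum_le_finite_sums[OF s]) (use assms(3) in auto)
  then show "ell2_norm X x \<le> M"
    unfolding ell2_norm_def using assms(2) by (metis real_le_lsqrt)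
qed

lemma ell2_scale: "x \<in> ell2 X \<Longrightarrow> (\<lambda>i. c * x i) \<in> ell2 X"
  by (auto simp: ell2_def norm_mult power_mult_distrib intro: summable_on_cmult_right)

lemma ell2_add:
  assumes "x \<in> ell2 X" "y \<in> ell2 X"
  shows "(\<lambda>i. x i + y i) \<in> ell2 X"
proof -
  have "(\<lambda>i. (cmod (x i + y i))\<^sup>2) summable_on X"
  proof (rule summable_on_comparison_test)
    show "(\<lambda>i. 2 * (cmod (x i))\<^sup>2 + 2 * (cmod (y i))\<^sup>2) summable_on X"
      using assms by (auto simp: ell2_def intro!: summable_on_add summable_on_cmult_right)
    fix i
    have "(cmod (x i + y i))\<^sup>2 \<le> (cmod (x i) + cmod (y i))\<^sup>2"
      by (intro power_mono norm_triangle_ineq) auto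
    also have "\<dots> \<le> 2 * (cmod (x i))\<^sup>2 + 2 * (cmod (y i))\<^sup>2"
      using sum_squares_bound[of "cmod (x i)" "cmod (y i)"]
      by (simp add: power2_sum)
    finally show "(cmod (x i + y i))\<^sup>2 \<le> 2 * (cmod (x i))\<^sup>2 + 2 * (cmod (y i))\<^sup>2" .
  qed auto
  then show ?thesis using assms by (auto simp: ell2_def)
qed

definition bounded_map ::
  "'a set \<Rightarrow> 'b set \<Rightarrow> (('a \<Rightarrow> complex) \<Rightarrow> ('b \<Rightarrow> complex)) \<Rightarrow> bool" where
  "bounded_map X Y A \<longleftrightarrow>
     (\<forall>x\<in>ell2 X. A x \<in> ell2 Y) \<and>
     (\<forall>x\<in>ell2 X. \<forall>y\<in>ell2 X. A (\<lambda>i. x i + y i) = (\<lambda>i. A x i + A y i)) \<and>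
     (\<forall>c. \<forall>x\<in>ell2 X. A (\<lambda>i. c * x i) = (\<lambda>i. c * A x i)) \<and>
     (\<exists>C. \<forall>x\<in>ell2 X. ell2_norm Y (A x) \<le> C * ell2_norm X x)"

lemma bounded_op_iff_bounded_map: "bounded_op X A \<longleftrightarrow> bounded_map X X A"
  by (simp add: bounded_op_def bounded_map_def)

lemma bounded_map_closed: "bounded_map X Y A \<Longrightarrow> x \<in> ell2 X \<Longrightarrow> A x \<in> ell2 Y"
  by (simp add: bounded_map_def)

lemma bounded_map_add:
  "bounded_map X Y A \<Longrightarrow> x \<in> ell2 X \<Longrightarrow> y \<in> ell2 X \<Longrightarrow> A (\<lambda>i. x i + y i) = (\<lambda>i. A x i + A y i)"
  by (simp add: bounded_map_def)

lemma bounded_map_scale: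
  "bounded_map X Y A \<Longrightarrow> x \<in> ell2 X \<Longrightarrow> A (\<lambda>i. c * x i) = (\<lambda>i. c * A x i)"
  by (simp add: bounded_map_def)

lemma bounded_map_sub_scale:
  assumes A: "bounded_map X Y A" and x: "x \<in> ell2 X" and y: "y \<in> ell2 X"
  shows "A (\<lambda>i. x i - c * y i) = (\<lambda>i. A x i - c * A y i)"
  using bounded_map_add[OF A x ell2_scale[OF y, of "- c"]] bounded_map_scale[OF A y, of "- c"]
  by simp

lemma bounded_map_bound:
  assumes "bounded_map X Y A"
  obtains C where "0 \<le> C" "\<And>x. x \<in> ell2 X \<Longrightarrow> ell2_norm Y (A x) \<le> C * ell2_norm X x"
proof -
  obtain C where C: "\<And>x. x \<in> ell2 X \<Longrightarrow> ell2_norm Y (A x) \<le> C * ell2_norm X x"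
    using assms unfolding bounded_map_def by blast
  have "ell2_norm Y (A x) \<le> \<bar>C\<bar> * ell2_norm X x" if "x \<in> ell2 X" for x
    using C[OF that] ell2_norm_nonneg[of X x]
    by (meson abs_ge_self mult_right_mono order_trans)
  then show ?thesis using that[of "\<bar>C\<bar>"] by simp
qed

lemma bounded_map_compose:
  assumes A: "bounded_map X Y A" and B: "bounded_map Y Z B"
  shows "bounded_map X Z (\<lambda>x. B (A x))"
proof -
  obtain a where a: "\<And>x. x \<in> ell2 X \<Longrightarrow> ell2_norm Y (A x) \<le> a * ell2_norm X x"
    using bounded_map_bound[OF A] by blast
  obtain b where b: "0 \<le> b" "\<And>y. y \<in> ell2 Y \<Longrightarrow> ell2_norm Z (B y) \<le> b * ell2_norm Y y"
    using bounded_map_bound[OF B] by blast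
  have "ell2_norm Z (B (A x)) \<le> (b * a) * ell2_norm X x" if x: "x \<in> ell2 X" for x
    using b(2)[OF bounded_map_closed[OF A x]] mult_left_mono[OF a[OF x] b(1)]
    by (simp add: mult.assoc)
  moreover have "B (A (\<lambda>i. x i + y i)) = (\<lambda>i. B (A x) i + B (A y) i)"
    if "x \<in> ell2 X" "y \<in> ell2 X" for x y
    using that by (simp add: bounded_map_add[OF A] bounded_map_add[OF B] bounded_map_closed[OF A])
  moreover have "B (A (\<lambda>i. c * x i)) = (\<lambda>i. c * B (A x) i)" if "x \<in> ell2 X" for c x
    using that by (simp add: bounded_map_scale[OF A] bounded_map_scale[OF B] bounded_map_closed[OF A])
  ultimately show ?thesis
    using bounded_map_closed[OF A] bounded_map_closed[OF B] unfolding bounded_map_def by blast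
qed

section \<open>Spectra of compressions and of direct sums\<close>

text \<open>
  The compression \<open>R B E\<close> of an inverse \<open>B\<close> of \<open>A' - z\<close> inverts
  \<open>A - z\<close>, because the intertwining relations move all factors past \<open>E\<close> and
  \<open>R\<close> until \<open>R E\<close> cancels. This covers similar operators (\<open>E\<close>
  invertible with inverse \<open>R\<close>) as well as direct summands (\<open>E\<close> an inclusion and
  \<open>R\<close> a projection that commutes with \<open>A'\<close>).
\<close>

lemma spec_subset_retract:
  assumes E: "bounded_map X Y E" and R: "bounded_map Y X R"
    and RE: "\<And>x. x \<in> ell2 X \<Longrightarrow> R (E x) = x"
    and A: "\<And>x. x \<in> ell2 X \<Longrightarrow> A x \<in> ell2 X"
    and A': "\<And>y. y \<in> ell2 Y \<Longrightarrow> A' y \<in> ell2 Y"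
    and EA: "\<And>x. x \<in> ell2 X \<Longrightarrow> E (A x) = A' (E x)"
    and RA: "\<And>y. y \<in> ell2 Y \<Longrightarrow> R (A' y) = A (R y)"
  shows "spec X A \<subseteq> spec Y A'"
proof (rule ccontr)
  assume "\<not> spec X A \<subseteq> spec Y A'"
  then obtain z B where z: "z \<in> spec X A" and B: "bounded_map Y Y B"
    and l: "\<And>y. y \<in> ell2 Y \<Longrightarrow> B (\<lambda>i. A' y i - z * y i) = y"
    and r: "\<And>y. y \<in> ell2 Y \<Longrightarrow> (\<lambda>i. A' (B y) i - z * B y i) = y"
    unfolding spec_def bounded_op_iff_bounded_map by blast
  let ?C = "\<lambda>x. R (B (E x))"
  have "bounded_map X X ?C"
    using bounded_map_compose[OF bounded_map_compose[OF E B] R] .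
  moreover have "?C (\<lambda>i. A x i - z * x i) = x" if x: "x \<in> ell2 X" for x
    using bounded_map_sub_scale[OF E A[OF x] x, of z] EA[OF x] RE[OF x]
      l[OF bounded_map_closed[OF E x]] by simp
  moreover have "(\<lambda>i. A (?C x) i - z * ?C x i) = x" if x: "x \<in> ell2 X" for x
  proof -
    have y: "B (E x) \<in> ell2 Y" by (intro bounded_map_closed[OF B] bounded_map_closed[OF E] x)
    show ?thesis
      using bounded_map_sub_scale[OF R A'[OF y] y, of z] RA[OF y] RE[OF x]
        r[OF bounded_map_closed[OF E x]] by simp
  qed
  ultimately show False using z unfolding spec_def bounded_op_iff_bounded_map by blast
qed

text \<open>
  On \<open>\<ell>\<^sup>2(W) \<otimes> \<ell>\<^sup>2(X) = \<ell>\<^sup>2(W \<times> X)\<close> this is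
  \<open>I \<otimes> A\<close>, the direct sum of copies of \<open>A\<close> indexed by \<open>W\<close>.
\<close>

definition ampliation ::
  "'w set \<Rightarrow> (('a \<Rightarrow> complex) \<Rightarrow> ('a \<Rightarrow> complex)) \<Rightarrow> ('w \<times> 'a \<Rightarrow> complex) \<Rightarrow> ('w \<times> 'a \<Rightarrow> complex)" where
  "ampliation W A x = (\<lambda>(w, i). if w \<in> W then A (\<lambda>j. x (w, j)) i else 0)"

lemma sum_singleton_times: "(\<Sum>p\<in>{w} \<times> F. g p) = (\<Sum>j\<in>F. g (w, j))"
  by (rule sum.reindex_bij_witness[of _ "Pair w" snd]) auto

lemma ell2_section:
  assumes "x \<in> ell2 (W \<times> X)"
  shows "(\<lambda>j. x (w, j)) \<in> ell2 X"
proof (rule ell2_norm_bound)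
  show "x (w, i) = 0" if "i \<notin> X" for i
    using ell2_zero_outside[OF assms] that by auto
  show "0 \<le> ell2_norm (W \<times> X) x" by (rule ell2_norm_nonneg)
  fix F assume F: "finite F" "F \<subseteq> X"
  show "(\<Sum>i\<in>F. (cmod (x (w, i)))\<^sup>2) \<le> (ell2_norm (W \<times> X) x)\<^sup>2"
  proof (cases "w \<in> W")
    case True
    then have "(\<Sum>p\<in>{w} \<times> F. (cmod (x p))\<^sup>2) \<le> (ell2_norm (W \<times> X) x)\<^sup>2"
      using F by (intro sum_le_ell2_norm assms) auto
    then show ?thesis by (simp add: sum_singleton_times)
  next
    case False
    then have "x (w, i) = 0" for i using ell2_zero_outside[OF assms] by auto
    then show ?thesis by simp
  qed
qed

lemma sum_sections_le_ell2_norm: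
  assumes x: "x \<in> ell2 (W \<times> X)" and V: "finite V" "V \<subseteq> W"
  shows "(\<Sum>w\<in>V. (ell2_norm X (\<lambda>j. x (w, j)))\<^sup>2) \<le> (ell2_norm (W \<times> X) x)\<^sup>2"
proof -
  let ?n = "\<lambda>p. (cmod (x p))\<^sup>2"
  have s: "(\<lambda>(w, j). ?n (w, j)) summable_on W \<times> X"
    using x by (simp add: ell2_def case_prod_unfold)
  have "(\<Sum>w\<in>V. (ell2_norm X (\<lambda>j. x (w, j)))\<^sup>2) = (\<Sum>w\<in>V. \<Sum>\<^sub>\<infinity>j\<in>X. ?n (w, j))"
    unfolding ell2_norm_def by (simp add: infsum_nonneg)
  also have "\<dots> \<le> (\<Sum>\<^sub>\<infinity>w\<in>W. \<Sum>\<^sub>\<infinity>j\<in>X. ?n (w, j))"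
  proof (rule finite_sum_le_infsum)
    show "(\<lambda>w. \<Sum>\<^sub>\<infinity>j\<in>X. ?n (w, j)) summable_on W"
      using summable_on_Sigma_banach[OF s] by simp
  qed (use V in \<open>auto simp: infsum_nonneg\<close>)
  also have "\<dots> = (\<Sum>\<^sub>\<infinity>p\<in>W \<times> X. ?n p)"
    using infsum_Sigma'_banach[OF s] by (simp add: case_prod_unfold)
  also have "\<dots> = (ell2_norm (W \<times> X) x)\<^sup>2"
    unfolding ell2_norm_def by (simp add: infsum_nonneg)
  finally show ?thesis .
qed

text \<open>
  All the summands have the same norm bound, so their direct sum has it too.
\<close>

lemma bounded_map_ampliation:
  assumes A: "bounded_map X X A"
  shows "bounded_map (W \<times> X) (W \<times> X) (ampliation W A)"
proof -
  obtain C where C: "0 \<le> C" "\<And>x. x \<in> ell2 X \<Longrightarrow> ell2_norm X (A x) \<le> C * ell2_norm X x"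
    using bounded_map_bound[OF A] by blast
  have bound: "ampliation W A x \<in> ell2 (W \<times> X) \<and>
      ell2_norm (W \<times> X) (ampliation W A x) \<le> C * ell2_norm (W \<times> X) x"
    if x: "x \<in> ell2 (W \<times> X)" for x
  proof -
    let ?s = "\<lambda>w j. x (w, j)"
    note sec = ell2_section[OF x]
    have zero: "ampliation W A x p = 0" if "p \<notin> W \<times> X" for p
      using that ell2_zero_outside[OF bounded_map_closed[OF A sec]]
      by (cases p) (auto simp: ampliation_def)
    have M: "0 \<le> C * ell2_norm (W \<times> X) x" by (rule mult_nonneg_nonneg[OF C(1) ell2_norm_nonneg])
    have "(\<Sum>p\<in>F. (cmod (ampliation W A x p))\<^sup>2) \<le> (C * ell2_norm (W \<times> X) x)\<^sup>2"
      if F: "finite F" "F \<subseteq> W \<times> X" for F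
    proof -
      have "(\<Sum>p\<in>F. (cmod (ampliation W A x p))\<^sup>2)
          \<le> (\<Sum>p\<in>fst ` F \<times> snd ` F. (cmod (ampliation W A x p))\<^sup>2)"
        using F by (intro sum_mono2) (auto simp: rev_image_eqI)
      also have "\<dots> = (\<Sum>w\<in>fst ` F. \<Sum>j\<in>snd ` F. (cmod (ampliation W A x (w, j)))\<^sup>2)"
        by (simp add: sum.cartesian_product)
      also have "\<dots> = (\<Sum>w\<in>fst ` F. \<Sum>j\<in>snd ` F. (cmod (A (?s w) j))\<^sup>2)"
        using F by (intro sum.cong refl) (auto simp: ampliation_def)
      also have "\<dots> \<le> (\<Sum>w\<in>fst ` F. (C * ell2_norm X (?s w))\<^sup>2)"
      proof (rule sum_mono)
        fix w
        have "(\<Sum>j\<in>snd ` F. (cmod (A (?s w) j))\<^sup>2) \<le> (ell2_norm X (A (?s w)))\<^sup>2"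
          using F by (intro sum_le_ell2_norm bounded_map_closed[OF A sec]) auto
        also have "\<dots> \<le> (C * ell2_norm X (?s w))\<^sup>2"
          by (intro power_mono C sec ell2_norm_nonneg)
        finally show "(\<Sum>j\<in>snd ` F. (cmod (A (?s w) j))\<^sup>2) \<le> (C * ell2_norm X (?s w))\<^sup>2" .
      qed
      also have "\<dots> = C\<^sup>2 * (\<Sum>w\<in>fst ` F. (ell2_norm X (?s w))\<^sup>2)"
        by (simp add: power_mult_distrib sum_distrib_left)
      also have "\<dots> \<le> C\<^sup>2 * (ell2_norm (W \<times> X) x)\<^sup>2"
        using F by (intro mult_left_mono sum_sections_le_ell2_norm x) auto
      finally show ?thesis by (simp add: power_mult_distrib)
    qed
    from ell2_norm_bound[OF zero M this] show ?thesis by blast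
  qed
  have add: "ampliation W A (\<lambda>i. x i + y i) = (\<lambda>i. ampliation W A x i + ampliation W A y i)"
    if "x \<in> ell2 (W \<times> X)" "y \<in> ell2 (W \<times> X)" for x y
    using bounded_map_add[OF A ell2_section[OF that(1)] ell2_section[OF that(2)]]
    by (auto simp: ampliation_def)
  have scale: "ampliation W A (\<lambda>i. c * x i) = (\<lambda>i. c * ampliation W A x i)"
    if "x \<in> ell2 (W \<times> X)" for c x
    using bounded_map_scale[OF A ell2_section[OF that]] by (auto simp: ampliation_def)
  show ?thesis unfolding bounded_map_def using bound add scale by blast
qed

lemma bounded_map_section:
  assumes "w \<in> W"
  shows "bounded_map (W \<times> X) X (\<lambda>x j. x (w, j))"
proof -
  have "ell2_norm X (\<lambda>j. x (w, j)) \<le> 1 * ell2_norm (W \<times> X) x" if "x \<in> ell2 (W \<times> X)" for x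
    using sum_sections_le_ell2_norm[OF that, of "{w}"] assms ell2_norm_nonneg[of "W \<times> X" x]
    by (simp add: power2_le_iff_abs_le)
  then show ?thesis unfolding bounded_map_def by (blast intro: ell2_section)
qed

lemma bounded_map_insert_section:
  assumes "w \<in> W"
  shows "bounded_map X (W \<times> X) (\<lambda>x (v, j). if v = w then x j else 0)"
proof -
  let ?E = "\<lambda>x (v, j). if v = w then x j else 0 :: complex"
  have b: "?E x \<in> ell2 (W \<times> X) \<and> ell2_norm (W \<times> X) (?E x) \<le> 1 * ell2_norm X x"
    if x: "x \<in> ell2 X" for x
  proof -
    have "(\<Sum>p\<in>F. (cmod (?E x p))\<^sup>2) \<le> (ell2_norm X x)\<^sup>2"
      if F: "finite F" "F \<subseteq> W \<times> X" for F
    proof -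
      have "(\<Sum>p\<in>F. (cmod (?E x p))\<^sup>2) \<le> (\<Sum>p\<in>F \<union> {w} \<times> snd ` F. (cmod (?E x p))\<^sup>2)"
        using F by (intro sum_mono2) auto
      also have "\<dots> = (\<Sum>p\<in>{w} \<times> snd ` F. (cmod (?E x p))\<^sup>2)"
        using F by (intro sum.mono_neutral_right) (auto simp: rev_image_eqI split: if_splits)
      also have "\<dots> = (\<Sum>j\<in>snd ` F. (cmod (x j))\<^sup>2)"
        by (simp add: sum_singleton_times)
      also have "\<dots> \<le> (ell2_norm X x)\<^sup>2"
        using F by (intro sum_le_ell2_norm x) auto
      finally show ?thesis .
    qed
    moreover have "?E x p = 0" if "p \<notin> W \<times> X" for p
      using that assms ell2_zero_outside[OF x] by (cases p) auto
    ultimately show ?thesis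
      using ell2_norm_bound[of "W \<times> X" "?E x" "ell2_norm X x"] ell2_norm_nonneg[of X x] by simp
  qed
  show ?thesis
    unfolding bounded_map_def
  proof (intro conjI ballI allI)
    show "\<exists>C. \<forall>x\<in>ell2 X. ell2_norm (W \<times> X) (?E x) \<le> C * ell2_norm X x"
      using b by blast
  qed (use b in auto)
qed

text \<open>
  Any one copy of \<open>A\<close> is a direct summand of the ampliation, which gives one inclusion.
  Conversely, if \<open>B\<close> inverts \<open>A - z\<close> then the ampliation of \<open>B\<close>,
  bounded by the same constant, inverts the ampliation minus \<open>z\<close>.
\<close>

lemma spec_ampliation:
  assumes A: "bounded_map X X A" and W: "W \<noteq> {}"
  shows "spec (W \<times> X) (ampliation W A) = spec X A"
proof (intro equalityI)
  obtain w where w: "w \<in> W" using W by blast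
  note AW = bounded_map_ampliation[OF A, of W]
  have A0: "A (\<lambda>_. 0) = (\<lambda>_. 0)"
  proof -
    have "(\<lambda>_. 0) \<in> ell2 X" by (rule ell2_finite_support[of "{}"]) auto
    then show ?thesis using bounded_map_sub_scale[OF A, of "\<lambda>_. 0" "\<lambda>_. 0" 1] 
      by (auto simp: fun_eq_iff)
  qed
  show "spec X A \<subseteq> spec (W \<times> X) (ampliation W A)"
  proof (rule spec_subset_retract[OF bounded_map_insert_section[OF w] bounded_map_section[OF w]])
    fix x :: "'a \<Rightarrow> complex" assume "x \<in> ell2 X"
    show "(\<lambda>(v, j). if v = w then A x j else 0)
        = ampliation W A (\<lambda>(v, j). if v = w then x j else 0)"
      using w A0 by (auto simp: ampliation_def fun_eq_iff)
  next
    fix y :: "'b \<times> 'a \<Rightarrow> complex"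
    show "(\<lambda>j. ampliation W A y (w, j)) = A (\<lambda>j. y (w, j))"
      using w by (simp add: ampliation_def)
  qed (use bounded_map_closed[OF A] bounded_map_closed[OF AW] in auto)
  show "spec (W \<times> X) (ampliation W A) \<subseteq> spec X A"
  proof
    fix z assume z: "z \<in> spec (W \<times> X) (ampliation W A)"
    show "z \<in> spec X A"
    proof (rule ccontr)
      assume "z \<notin> spec X A"
      then obtain B where B: "bounded_map X X B"
        and l: "\<And>x. x \<in> ell2 X \<Longrightarrow> B (\<lambda>i. A x i - z * x i) = x"
        and r: "\<And>x. x \<in> ell2 X \<Longrightarrow> (\<lambda>i. A (B x) i - z * B x i) = x"
        unfolding spec_def bounded_op_iff_bounded_map by blast
      have "ampliation W B (\<lambda>i. ampliation W A x i - z * x i) = x \<and>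
          (\<lambda>i. ampliation W A (ampliation W B x) i - z * ampliation W B x i) = x"
        if x: "x \<in> ell2 (W \<times> X)" for x
      proof -
        have "x (w, i) = 0" if "w \<notin> W" for w i
          using ell2_zero_outside[OF x, of "(w, i)"] that by auto
        then show ?thesis
          using l[OF ell2_section[OF x]] fun_cong[OF r[OF ell2_section[OF x]]]
          by (auto simp: ampliation_def fun_eq_iff)
      qed
      then show False
        using z bounded_map_ampliation[OF B, of W]
        unfolding spec_def bounded_op_iff_bounded_map by blast
    qed
  qed
qed

section \<open>Bounded Toeplitz operators\<close>

text \<open>
  A matrix is bounded as soon as its finite sections are bounded by a common constant. Testing a section with
  a single row against that row itself shows that the row is square summable, so that the series defining the
  operator converges; then the bound passes to the limit.
\<close>

lemma bounded_map_kernel_op: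
  assumes C: "0 \<le> C"
    and sec: "\<And>x F G. finite F \<Longrightarrow> F \<subseteq> X \<Longrightarrow> finite G \<Longrightarrow> G \<subseteq> X \<Longrightarrow>
      (\<Sum>i\<in>G. (cmod (\<Sum>j\<in>F. K i j * x j))\<^sup>2) \<le> C\<^sup>2 * (\<Sum>j\<in>F. (cmod (x j))\<^sup>2)"
  shows "bounded_map X X (kernel_op X K)"
proof -
  have row: "(\<lambda>j. (cmod (K i j))\<^sup>2) summable_on X" if i: "i \<in> X" for i
  proof (rule nonneg_bdd_above_summable_on)
    have "(\<Sum>j\<in>F. (cmod (K i j))\<^sup>2) \<le> C\<^sup>2" if F: "finite F" "F \<subseteq> X" for F
    proof -
      let ?S = "\<Sum>j\<in>F. (cmod (K i j))\<^sup>2"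
      have "(\<Sum>j\<in>F. K i j * cnj (K i j)) = of_real ?S"
        by (simp add: complex_norm_square del: of_real_power)
      then have "?S\<^sup>2 \<le> C\<^sup>2 * ?S"
        using sec[OF F, of "{i}" "\<lambda>j. cnj (K i j)"] i by (simp add: norm_of_real del: of_real_sum)
      moreover have "0 \<le> ?S" by (simp add: sum_nonneg)
      ultimately show ?thesis
        by (cases "?S = 0") (simp_all add: power2_eq_square mult_le_cancel_right)
    qed
    then show "bdd_above (sum (\<lambda>j. (cmod (K i j))\<^sup>2) ` {F. F \<subseteq> X \<and> finite F})"
      by (auto intro!: bdd_aboveI[of _ "C\<^sup>2"])
  qed auto
  have summ: "(\<lambda>j. K i j * x j) summable_on X" if i: "i \<in> X" and x: "x \<in> ell2 X" for i x
  proof (rule abs_summable_summable, rule summable_on_comparison_test)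
    show "(\<lambda>j. (cmod (K i j))\<^sup>2 + (cmod (x j))\<^sup>2) summable_on X"
      using row[OF i] x by (auto simp: ell2_def intro: summable_on_add)
    fix j
    show "norm (K i j * x j) \<le> (cmod (K i j))\<^sup>2 + (cmod (x j))\<^sup>2"
      using sum_squares_bound[of "cmod (K i j)" "cmod (x j)"]
        mult_nonneg_nonneg[OF norm_ge_zero norm_ge_zero, of "K i j" "x j"]
      unfolding norm_mult mult.assoc by linarith
  qed auto
  have bound: "kernel_op X K x \<in> ell2 X \<and> ell2_norm X (kernel_op X K x) \<le> C * ell2_norm X x"
    if x: "x \<in> ell2 X" for x
  proof -
    have "(\<Sum>i\<in>G. (cmod (kernel_op X K x i))\<^sup>2) \<le> (C * ell2_norm X x)\<^sup>2"
      if G: "finite G" "G \<subseteq> X" for G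
    proof (rule tendsto_upperbound)
      show "((\<lambda>F. \<Sum>i\<in>G. (cmod (\<Sum>j\<in>F. K i j * x j))\<^sup>2) \<longlongrightarrow> (\<Sum>i\<in>G. (cmod (kernel_op X K x i))\<^sup>2))
          (finite_subsets_at_top X)"
      proof (intro tendsto_intros)
        fix i assume "i \<in> G"
        then show "((\<lambda>F. \<Sum>j\<in>F. K i j * x j) \<longlongrightarrow> kernel_op X K x i) (finite_subsets_at_top X)"
          using G infsum_tendsto[OF summ[OF _ x, of i]] by (auto simp: kernel_op_def)
      qed
      have "(\<Sum>i\<in>G. (cmod (\<Sum>j\<in>F. K i j * x j))\<^sup>2) \<le> (C * ell2_norm X x)\<^sup>2"
        if F: "finite F" "F \<subseteq> X" for F
        using sec[OF F G, of x] mult_left_mono[OF sum_le_ell2_norm[OF x F], of "C\<^sup>2"]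
        by (simp add: power_mult_distrib)
      then show "\<forall>\<^sub>F F in finite_subsets_at_top X.
          (\<Sum>i\<in>G. (cmod (\<Sum>j\<in>F. K i j * x j))\<^sup>2) \<le> (C * ell2_norm X x)\<^sup>2"
        by (intro eventually_finite_subsets_at_top_weakI) auto
    qed auto
    moreover have "kernel_op X K x i = 0" if "i \<notin> X" for i
      using that by (simp add: kernel_op_def)
    moreover have "0 \<le> C * ell2_norm X x" by (rule mult_nonneg_nonneg[OF C ell2_norm_nonneg])
    ultimately show ?thesis using ell2_norm_bound[of X "kernel_op X K x" "C * ell2_norm X x"] by blast
  qed
  have "kernel_op X K (\<lambda>i. x i + y i) = (\<lambda>i. kernel_op X K x i + kernel_op X K y i)"
    if "x \<in> ell2 X" "y \<in> ell2 X" for x y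
    using summ that by (auto simp: kernel_op_def fun_eq_iff distrib_left infsum_add)
  moreover have "kernel_op X K (\<lambda>i. c * x i) = (\<lambda>i. c * kernel_op X K x i)" for c x
    by (auto simp: kernel_op_def fun_eq_iff mult.left_commute infsum_cmult_right')
  ultimately show ?thesis unfolding bounded_map_def using bound by blast
qed

abbreviation period_measure :: "real measure" where
  "period_measure \<equiv> lebesgue_on {0..2*pi}"

lemma finite_measure_period: "finite_measure period_measure"
  by (intro finite_measure_lebesgue_on) auto

lemma integrable_period_bounded:
  fixes h :: "real \<Rightarrow> complex"
  assumes "h \<in> borel_measurable period_measure" "AE \<theta> in period_measure. cmod (h \<theta>) \<le> B"
  shows "integrable period_measure h"
  by (rule finite_measure.integrable_const_bound[OF finite_measure_period assms(2,1)])

lemma continuous_measurable_period: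
  fixes h :: "real \<Rightarrow> 'a::euclidean_space"
  assumes "continuous_on UNIV h"
  shows "h \<in> borel_measurable period_measure"
  by (intro continuous_imp_measurable_on_sets_lebesgue continuous_on_subset[OF assms]) auto

lemma cis_measurable_period [measurable]: "(\<lambda>\<theta>. cis (a * \<theta>)) \<in> borel_measurable period_measure"
  by (intro continuous_measurable_period continuous_intros)

lemma integral_cis_period:
  "(LINT \<theta>|period_measure. cis (of_int n * \<theta>)) = (if n = 0 then of_real (2 * pi) else 0)"
proof -
  have int: "integrable period_measure (\<lambda>\<theta>. cis (of_int n * \<theta>))"
    by (rule integrable_period_bounded[where B = 1]) auto
  have "((\<lambda>\<theta>. cis (of_int n * \<theta>)) has_integral (if n = 0 then of_real (2 * pi) else 0)) {0..2*pi}"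
  proof (cases "n = 0")
    case True
    then show ?thesis using has_integral_const_real[of "1::complex" 0 "2*pi"]
      by (simp add: scaleR_conv_of_real)
  next
    case False
    let ?F = "\<lambda>\<theta>. cis (of_int n * \<theta>) / (\<i> * of_int n)"
    have "((\<lambda>\<theta>. cis (of_int n * \<theta>)) has_integral (?F (2*pi) - ?F 0)) {0..2*pi}"
    proof (rule fundamental_theorem_of_calculus)
      fix \<theta> :: real
      have "((\<lambda>z. exp (\<i> * of_int n * z) / (\<i> * of_int n)) has_field_derivative
          exp (\<i> * of_int n * of_real \<theta>)) (at (of_real \<theta>))"
        using False by (auto intro!: derivative_eq_intros)
      from has_vector_derivative_real_field[OF this] show "(?F has_vector_derivative cis (of_int n * \<theta>)) (at \<theta> within {0..2*pi})"
        by (simp add: cis_conv_exp mult.assoc)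
    qed auto
    moreover have "?F (2*pi) = ?F 0"
      using cis_multiple_2pi[of "of_int n"] by (simp add: mult.commute)
    ultimately show ?thesis using False by simp
  qed
  then show ?thesis
    using lebesgue_integral_eq_integral[OF int] by (simp add: integral_unique)
qed

text \<open>
  Parseval's identity for trigonometric polynomials, from the orthogonality of the characters.
\<close>

lemma integral_trig_poly_norm_square:
  fixes c :: "int \<Rightarrow> complex"
  assumes "finite G"
  shows "(LINT \<theta>|period_measure. (cmod (\<Sum>k\<in>G. c k * cis (of_int k * \<theta>)))\<^sup>2)
    = 2 * pi * (\<Sum>k\<in>G. (cmod (c k))\<^sup>2)"
proof -
  have int: "integrable period_measure (\<lambda>\<theta>. cis (of_int n * \<theta>))" for n
    by (rule integrable_period_bounded[where B = 1]) auto
  have "of_real (LINT \<theta>|period_measure. (cmod (\<Sum>k\<in>G. c k * cis (of_int k * \<theta>)))\<^sup>2)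
    = (LINT \<theta>|period_measure. (complex_of_real ((cmod (\<Sum>k\<in>G. c k * cis (of_int k * \<theta>)))\<^sup>2)))"
    by (rule integral_complex_of_real[symmetric])
  also have "\<dots> = (LINT \<theta>|period_measure. (\<Sum>k\<in>G. \<Sum>l\<in>G. (c k * cnj (c l)) * cis (of_int (k - l) * \<theta>)))"
    unfolding complex_norm_square
    by (simp add: sum_product cis_cnj cis_mult algebra_simps)
  also have "\<dots> = (\<Sum>k\<in>G. \<Sum>l\<in>G. (c k * cnj (c l)) * (if k - l = 0 then of_real (2 * pi) else 0))"
    unfolding integral_cis_period[symmetric] using int
    by (simp add: Bochner_Integration.integral_sum Bochner_Integration.integrable_sum del: of_int_diff)
  also have "\<dots> = (\<Sum>k\<in>G. \<Sum>l\<in>G. if l = k then of_real (2 * pi) * (c k * cnj (c k)) else 0)"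
    by (intro sum.cong) auto
  also have "\<dots> = of_real (2 * pi * (\<Sum>k\<in>G. (cmod (c k))\<^sup>2))"
    using assms by (simp add: sum_distrib_left complex_norm_square del: of_real_power)
  finally show ?thesis by (simp only: of_real_eq_iff)
qed

text \<open>
  With \<open>s = \<Sum>\<^sub>k c\<^sub>k e\<^sup>i\<^sup>k\<^sup>\<theta>\<close> the partial Fourier sum,
  expanding \<open>0 \<le> \<parallel>h - s\<parallel>\<^sup>2\<close> gives the claim, because both
  \<open>\<langle>h, s\<rangle>\<close> and \<open>\<parallel>s\<parallel>\<^sup>2\<close> are equal to
  \<open>2 \<pi> \<Sum>\<^sub>k |c\<^sub>k|\<^sup>2\<close>.
\<close>

lemma bessel_inequality_period:
  fixes h :: "real \<Rightarrow> complex"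
  assumes h: "h \<in> borel_measurable period_measure" "AE \<theta> in period_measure. cmod (h \<theta>) \<le> B"
    and G: "finite G"
    and c: "\<And>k. c k = (LINT \<theta>|period_measure. h \<theta> * cis (- (of_int k * \<theta>))) / of_real (2 * pi)"
  shows "2 * pi * (\<Sum>k\<in>G. (cmod (c k))\<^sup>2) \<le> (LINT \<theta>|period_measure. (cmod (h \<theta>))\<^sup>2)"
proof -
  note [measurable] = h(1)
  let ?s = "\<lambda>\<theta>. \<Sum>k\<in>G. c k * cis (of_int k * \<theta>)"
  let ?N = "\<Sum>k\<in>G. (cmod (c k))\<^sup>2"
  have cism [measurable]: "(\<lambda>\<theta>. cis (- (of_int k * \<theta>))) \<in> borel_measurable period_measure" for k
    by (intro continuous_measurable_period continuous_intros)
  have s_bound: "cmod (?s \<theta>) \<le> (\<Sum>k\<in>G. cmod (c k))" for \<theta>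
    by (rule order_trans[OF norm_sum]) (simp add: norm_mult)
  have i1: "integrable period_measure (\<lambda>\<theta>. (cmod (h \<theta>))\<^sup>2)"
    by (rule finite_measure.integrable_const_bound[OF finite_measure_period, of _ "B\<^sup>2"])
       (use h(2) in \<open>auto elim!: eventually_mono intro!: power_mono\<close>)
  have i2: "integrable period_measure (\<lambda>\<theta>. (cmod (?s \<theta>))\<^sup>2)"
    by (rule finite_measure.integrable_const_bound[OF finite_measure_period, of _ "(\<Sum>k\<in>G. cmod (c k))\<^sup>2"])
       (auto intro!: power_mono s_bound AE_I2)
  have ik: "integrable period_measure (\<lambda>\<theta>. h \<theta> * cis (- (of_int k * \<theta>)))" for k
    by (rule integrable_period_bounded[of _ B]) (use h(2) in \<open>auto simp: norm_mult\<close>)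
  have hs: "h \<theta> * cnj (?s \<theta>) = (\<Sum>k\<in>G. cnj (c k) * (h \<theta> * cis (- (of_int k * \<theta>))))" for \<theta>
    by (simp add: sum_distrib_left cis_cnj mult_ac)
  have i3: "integrable period_measure (\<lambda>\<theta>. h \<theta> * cnj (?s \<theta>))"
    unfolding hs using ik by (intro Bochner_Integration.integrable_sum integrable_mult_right)
  have "(LINT \<theta>|period_measure. h \<theta> * cnj (?s \<theta>)) = (\<Sum>k\<in>G. cnj (c k) * (of_real (2 * pi) * c k))"
    unfolding hs using ik by (simp add: c Bochner_Integration.integral_sum)
  also have "\<dots> = of_real (2 * pi * ?N)"
    by (simp add: complex_norm_square sum_distrib_left mult_ac del: of_real_power)
  finally have e3: "(LINT \<theta>|period_measure. Re (h \<theta> * cnj (?s \<theta>))) = 2 * pi * ?N"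
    using integral_Re[OF i3] by simp
  have i4: "integrable period_measure (\<lambda>\<theta>. Re (h \<theta> * cnj (?s \<theta>)))"
    using i3 by (rule integrable_Re)
  have expand2: "(cmod (a - b))\<^sup>2 = (cmod a)\<^sup>2 - 2 * Re (a * cnj b) + (cmod b)\<^sup>2" for a b
    unfolding cmod_power2 by (simp add: power2_eq_square algebra_simps)
  have expand: "(cmod (h \<theta> - ?s \<theta>))\<^sup>2 = (cmod (h \<theta>))\<^sup>2 - 2 * Re (h \<theta> * cnj (?s \<theta>)) + (cmod (?s \<theta>))\<^sup>2" for \<theta>
    using expand2 .
  have linear: "(LINT \<theta>|period_measure. a \<theta> - 2 * r \<theta> + b \<theta>)
      = (LINT \<theta>|period_measure. a \<theta>) - 2 * (LINT \<theta>|period_measure. r \<theta>) + (LINT \<theta>|period_measure. b \<theta>)"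
    if "integrable period_measure a" "integrable period_measure r" "integrable period_measure b"
    for a r b :: "real \<Rightarrow> real"
    using that by simp
  have "0 \<le> (LINT \<theta>|period_measure. (cmod (h \<theta> - ?s \<theta>))\<^sup>2)" by simp
  also have "\<dots> = (LINT \<theta>|period_measure. (cmod (h \<theta>))\<^sup>2) - 2 * (2 * pi * ?N) + 2 * pi * ?N"
    unfolding expand linear[OF i1 i4 i2] e3 integral_trig_poly_norm_square[OF G] ..
  finally show ?thesis by simp
qed

text \<open>
  For finitely supported \<open>x\<close> let \<open>p\<close> be the trigonometric polynomial with
  coefficients \<open>x\<close>. Then \<open>T(f) x\<close> consists of the nonnegative Fourier coefficients
  of \<open>f p\<close>, so its norm is at most that of \<open>f p\<close> by Bessel's inequality, hence at
  most \<open>\<parallel>f\<parallel>\<^sub>\<infinity>\<close> times the norm of \<open>p\<close>, which is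
  the norm of \<open>x\<close> by Parseval's identity.
\<close>

lemma bounded_map_Toeplitz_op:
  assumes "f \<in> Linf_circle"
  shows "bounded_map UNIV UNIV (Toeplitz_op f)"
proof -
  let ?g = "\<lambda>\<theta>. f (cis \<theta>)"
  have g [measurable]: "?g \<in> borel_measurable period_measure"
    using assms by (simp add: Linf_circle_def)
  obtain C0 where C0: "AE \<theta> in period_measure. cmod (?g \<theta>) \<le> C0"
    using assms by (auto simp: Linf_circle_def)
  define C where "C = \<bar>C0\<bar>"
  have C: "AE \<theta> in period_measure. cmod (?g \<theta>) \<le> C" "0 \<le> C"
    using C0 by (auto simp: C_def elim!: eventually_mono)
  show ?thesis
    unfolding Toeplitz_op_def
  proof (rule bounded_map_kernel_op[OF C(2)])
    fix x :: "nat \<Rightarrow> complex" and F G :: "nat set"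
    assume F: "finite F" and G: "finite G"
    let ?p = "\<lambda>\<theta>. \<Sum>l\<in>F. x l * cis (of_int (int l) * \<theta>)"
    let ?S = "\<Sum>l\<in>F. (cmod (x l))\<^sup>2"
    have p_bound: "cmod (?p \<theta>) \<le> (\<Sum>l\<in>F. cmod (x l))" for \<theta>
      by (rule order_trans[OF norm_sum]) (simp add: norm_mult)
    have cism [measurable]: "(\<lambda>\<theta>. cis (- (of_int k * \<theta>))) \<in> borel_measurable period_measure" for k
      by (intro continuous_measurable_period continuous_intros)
    have ik: "integrable period_measure (\<lambda>\<theta>. ?g \<theta> * cis (- (of_int k * \<theta>)))" for k
      by (rule integrable_period_bounded[of _ C]) (use C in \<open>auto simp: norm_mult\<close>)
    have coeff: "(\<Sum>l\<in>F. fourier_coeff f (int k - int l) * x l)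
        = (LINT \<theta>|period_measure. (?g \<theta> * ?p \<theta>) * cis (- (of_int (int k) * \<theta>))) / of_real (2 * pi)" for k
    proof -
      have "(?g \<theta> * ?p \<theta>) * cis (- (of_int (int k) * \<theta>))
          = (\<Sum>l\<in>F. x l * (?g \<theta> * cis (- (of_int (int k - int l) * \<theta>))))" for \<theta>
      proof -
        have "cis (- (of_int (int k - int l) * \<theta>)) = cis (of_int (int l) * \<theta>) * cis (- (of_int (int k) * \<theta>))" for l
          by (simp add: cis_mult algebra_simps)
        then show ?thesis by (simp add: sum_distrib_left sum_distrib_right mult_ac)
      qed
      then show ?thesis
        using ik by (simp add: fourier_coeff_def Bochner_Integration.integral_sum sum_divide_distrib
            mult.commute del: of_int_diff)
    qed
    have b: "AE \<theta> in period_measure. cmod (?g \<theta> * ?p \<theta>) \<le> C * (\<Sum>l\<in>F. cmod (x l))"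
      using C(1)
    proof eventually_elim
      case (elim \<theta>)
      then show ?case unfolding norm_mult by (intro mult_mono p_bound C(2)) auto
    qed
    have m: "(\<lambda>\<theta>. ?g \<theta> * ?p \<theta>) \<in> borel_measurable period_measure" by measurable
    have "2 * pi * (\<Sum>k\<in>int ` G. (cmod ((LINT \<theta>|period_measure. (?g \<theta> * ?p \<theta>) * cis (- (of_int k * \<theta>))) / of_real (2 * pi)))\<^sup>2)
        \<le> (LINT \<theta>|period_measure. (cmod (?g \<theta> * ?p \<theta>))\<^sup>2)"
      by (rule bessel_inequality_period[OF m b]) (use G in auto)
    also have "(\<Sum>k\<in>int ` G. (cmod ((LINT \<theta>|period_measure. (?g \<theta> * ?p \<theta>) * cis (- (of_int k * \<theta>))) / of_real (2 * pi)))\<^sup>2)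
        = (\<Sum>k\<in>G. (cmod (\<Sum>l\<in>F. fourier_coeff f (int k - int l) * x l))\<^sup>2)"
      unfolding coeff by (simp add: sum.reindex)
    also have "(LINT \<theta>|period_measure. (cmod (?g \<theta> * ?p \<theta>))\<^sup>2) \<le> (LINT \<theta>|period_measure. C\<^sup>2 * (cmod (?p \<theta>))\<^sup>2)"
    proof (rule integral_mono_AE)
      show "integrable period_measure (\<lambda>\<theta>. (cmod (?g \<theta> * ?p \<theta>))\<^sup>2)"
        by (rule finite_measure.integrable_const_bound[OF finite_measure_period, of _ "(C * (\<Sum>l\<in>F. cmod (x l)))\<^sup>2"])
           (use b in \<open>auto elim!: eventually_mono intro!: power_mono simp del: norm_mult\<close>)
      show "integrable period_measure (\<lambda>\<theta>. C\<^sup>2 * (cmod (?p \<theta>))\<^sup>2)"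
        by (intro integrable_mult_right
            finite_measure.integrable_const_bound[OF finite_measure_period, of _ "(\<Sum>l\<in>F. cmod (x l))\<^sup>2"])
           (auto intro!: power_mono p_bound AE_I2 simp del: of_int_of_nat_eq)
      show "AE \<theta> in period_measure. (cmod (?g \<theta> * ?p \<theta>))\<^sup>2 \<le> C\<^sup>2 * (cmod (?p \<theta>))\<^sup>2"
        using C(1)
        by eventually_elim (auto simp: norm_mult power_mult_distrib intro!: mult_right_mono power_mono)
    qed
    also have "\<dots> = C\<^sup>2 * (2 * pi * ?S)"
    proof -
      have "?p = (\<lambda>\<theta>. \<Sum>k\<in>int ` F. x (nat k) * cis (of_int k * \<theta>))"
        by (simp add: sum.reindex)
      then have "(LINT \<theta>|period_measure. (cmod (?p \<theta>))\<^sup>2) = 2 * pi * ?S"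
        using integral_trig_poly_norm_square[of "int ` F" "\<lambda>k. x (nat k)"] F
        by (simp add: sum.reindex)
      then show ?thesis by simp
    qed
    finally show "(\<Sum>k\<in>G. (cmod (\<Sum>l\<in>F. fourier_coeff f (int k - int l) * x l))\<^sup>2) \<le> C\<^sup>2 * ?S"
      by (simp add: mult.left_commute)
  qed
qed

section \<open>Distance and order in the tree\<close>

lemma tree_append: "u @ s \<in> tree q \<longleftrightarrow> u \<in> tree q \<and> s \<in> tree q"
  by (simp add: tree_def)

lemma edge_length:
  assumes "(u, v) \<in> tree_edges q"
  shows "length v \<le> Suc (length u)" "length u \<le> Suc (length v)"
  using assms by (auto simp: tree_edges_def)

text \<open>
  An edge changes the level by one, so a path is at least as long as the difference of levels. This is the
  lower bound for every distance that is needed.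
\<close>

lemma path_length:
  assumes "(u, v) \<in> tree_edges q ^^ n"
  shows "length v \<le> length u + n \<and> length u \<le> length v + n"
  using assms
proof (induction n arbitrary: v)
  case (Suc n)
  then obtain w where "(u, w) \<in> tree_edges q ^^ n" "(w, v) \<in> tree_edges q" by auto
  with Suc.IH[of w] edge_length[of w v q] show ?case by auto
qed simp

lemma path_down:
  assumes "u @ s \<in> tree q"
  shows "(u, u @ s) \<in> tree_edges q ^^ length s"
  using assms
proof (induction s rule: rev_induct)
  case (snoc a s)
  then have "(u @ s, (u @ s) @ [a]) \<in> tree_edges q"
    by (auto simp: tree_edges_def tree_append)
  moreover have "(u, u @ s) \<in> tree_edges q ^^ length s"
    using snoc by (auto simp: tree_append)
  ultimately show ?case by auto
qed simp

lemma sym_tree_edges: "sym (tree_edges q)"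
  by (auto simp: sym_def tree_edges_def)

lemma path_sym: "(u, v) \<in> tree_edges q ^^ n \<Longrightarrow> (v, u) \<in> tree_edges q ^^ n"
proof (induction n arbitrary: u v)
  case (Suc n)
  then obtain w where "(u, w) \<in> tree_edges q ^^ n" "(w, v) \<in> tree_edges q" by auto
  then have "(v, w) \<in> tree_edges q" "(w, u) \<in> tree_edges q ^^ n"
    using Suc.IH sym_tree_edges by (auto dest: symD)
  then show ?case by (meson relpow_Suc_I2)
qed simp

lemma tree_dist_sym: "tree_dist q u v = tree_dist q v u"
  proof -
  have "(u, v) \<in> tree_edges q ^^ n \<longleftrightarrow> (v, u) \<in> tree_edges q ^^ n" for n
    using path_sym by blast
  then show ?thesis by (simp add: tree_dist_def)
qed

lemma tree_dist_append:
  assumes "u @ s \<in> tree q"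
  shows "tree_dist q u (u @ s) = length s"
  unfolding tree_dist_def
  by (rule Least_equality) (use path_down[OF assms] path_length in force)+

lemma level_eq_length: "u \<in> tree q \<Longrightarrow> level q u = length u"
  unfolding level_def using tree_dist_append[of "[]" u q] by simp

text \<open>
  Any two vertices are joined by a path through the root; therefore the least length in the definition of the
  distance is attained.
\<close>

lemma path_of_dist:
  assumes "u \<in> tree q" "v \<in> tree q"
  shows "(u, v) \<in> tree_edges q ^^ tree_dist q u v"
proof -
  have "(u, []) \<in> tree_edges q ^^ length u" "([], v) \<in> tree_edges q ^^ length v"
    using path_down[of "[]" _ q] assms path_sym by auto
  then have "(u, v) \<in> tree_edges q ^^ (length u + length v)"
    by (auto simp: relpow_add)
  then show ?thesis unfolding tree_dist_def by (rule LeastI)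
qed

text \<open>
  A geodesic ray from the root descends one level at each step, because its \<open>n\<close>-th vertex has
  distance \<open>n\<close> from the root.
\<close>

lemma ray_prefix:
  assumes "rooted_geodesic_ray q \<gamma>"
  shows "length (\<gamma> n) = n" "prefix (\<gamma> n) (\<gamma> (n + k))"
proof -
  have t: "\<gamma> n \<in> tree q" for n
    using assms by (auto simp: rooted_geodesic_ray_def)
  have d: "int (tree_dist q (\<gamma> m) (\<gamma> n)) = \<bar>int m - int n\<bar>" for m n
    using assms by (auto simp: rooted_geodesic_ray_def)
  have len: "length (\<gamma> n) = n" for n
    using d[of 0 n] assms level_eq_length[OF t, of n]
    by (simp add: level_def rooted_geodesic_ray_def)
  then show "length (\<gamma> n) = n" .
  have step: "prefix (\<gamma> n) (\<gamma> (Suc n))" for n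
  proof -
    have "tree_dist q (\<gamma> n) (\<gamma> (Suc n)) = 1" using d[of n "Suc n"] by simp
    then have "(\<gamma> n, \<gamma> (Suc n)) \<in> tree_edges q"
      using path_of_dist[OF t t, of n "Suc n"] by simp
    then show ?thesis using len[of n] len[of "Suc n"] by (force simp: tree_edges_def)
  qed
  show "prefix (\<gamma> n) (\<gamma> (n + k))"
    by (induction k) (use step prefix_order.trans in auto)
qed

text \<open>
  Descending to \<open>v\<close> and then always to the child labelled \<open>0\<close> is a geodesic ray.
\<close>

lemma ray_through:
  assumes "v \<in> tree q" "q \<ge> 1"
  shows "rooted_geodesic_ray q (\<lambda>n. take n v @ replicate (n - length v) 0)" (is "rooted_geodesic_ray q ?r")
proof -
  have t: "?r n \<in> tree q" for n
    using assms by (auto simp: tree_def dest: in_set_takeD)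
  have dist: "tree_dist q (?r m) (?r (m + k)) = k" for m k
  proof -
    \<comment> \<open>The vertices of the ray are prefixes of one another.\<close>
    have "take m (?r (m + k)) = ?r m" by (auto simp: min_def not_le)
    then obtain s where s: "?r (m + k) = ?r m @ s" by (metis append_take_drop_id)
    from arg_cong[OF s, of length] have "length s = k" by simp
    then show ?thesis using tree_dist_append[of "?r m" s q] t[of "m + k"] unfolding s by blast
  qed
  have "int (tree_dist q (?r m) (?r n)) = \<bar>int m - int n\<bar>" for m n
  proof (cases "m \<le> n")
    case True then show ?thesis using dist[of m "n - m"] by simp
  next
    case False then show ?thesis using dist[of n "m - n"] tree_dist_sym[of q "?r m" "?r n"] by simp
  qed
  then show ?thesis unfolding rooted_geodesic_ray_def using t by auto
qed

lemma tree_le_iff_prefix: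
  assumes "q \<ge> 1" "u \<in> tree q" "v \<in> tree q"
  shows "tree_le q u v \<longleftrightarrow> prefix u v"
proof
  assume "tree_le q u v"
  then obtain \<gamma> m n where g: "rooted_geodesic_ray q \<gamma>" "u = \<gamma> m" "v = \<gamma> n" "level q u \<le> level q v"
    by (auto simp: tree_le_def)
  have "m \<le> n" using g(4) level_eq_length assms(2,3) ray_prefix(1)[OF g(1)] unfolding g(2,3) by simp
  then show "prefix u v" using ray_prefix(2)[OF g(1), of m "n - m"] g by simp
next
  assume p: "prefix u v"
  let ?r = "\<lambda>n. take n v @ replicate (n - length v) 0"
  have "u = ?r (length u)" using p by (auto simp: prefix_def)
  moreover have "v = ?r (length v)" by simp
  ultimately have "u \<in> range ?r" "v \<in> range ?r" by blast+
  moreover have "level q u \<le> level q v"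
    using p assms by (simp add: level_eq_length prefix_length_le)
  ultimately show "tree_le q u v"
    unfolding tree_le_def using ray_through[OF assms(3,1)] by blast
qed

text \<open>
  For comparable vertices the distance and the difference of the levels are both the length of the segment
  between them; the factor \<open>q\<^sup>-\<^sup>1\<^sup>/\<^sup>2\<close> per edge is the matrix entry of
  one step of \<open>S\<close>.
\<close>

lemma Gamma_kernel_append:
  assumes q: "q \<ge> 1" and "u @ s \<in> tree q"
  shows "Gamma_kernel q f (u @ s) u = fourier_coeff f (int (length s)) / of_real (sqrt q) ^ length s"
    and "Gamma_kernel q f u (u @ s) = fourier_coeff f (- int (length s)) / of_real (sqrt q) ^ length s"
proof -
  have u: "u \<in> tree q" using assms by (simp add: tree_append)
  have c: "(u, u @ s) \<in> comparable_pairs q" "(u @ s, u) \<in> comparable_pairs q"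
    using assms u by (auto simp: comparable_pairs_def tree_le_iff_prefix)
  have d: "tree_dist q u (u @ s) = length s" "tree_dist q (u @ s) u = length s"
    using tree_dist_append[OF assms(2)] tree_dist_sym by metis+
  have "real q powr (- real (length s) / 2) = (real q powr (1/2)) powr (- real (length s))"
    by (simp add: powr_powr)
  also have "\<dots> = inverse (sqrt q ^ length s)"
    using q by (simp add: powr_half_sqrt powr_minus powr_realpow)
  finally have p: "real q powr (- real (length s) / 2) = inverse (sqrt q ^ length s)" .
  have p': "complex_of_real (real q powr (- (real (length s) / 2))) = inverse (of_real (sqrt q) ^ length s)"
    using p by simp
  show "Gamma_kernel q f (u @ s) u = fourier_coeff f (int (length s)) / of_real (sqrt q) ^ length s"
    "Gamma_kernel q f u (u @ s) = fourier_coeff f (- int (length s)) / of_real (sqrt q) ^ length s"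
    using c d p' level_eq_length[OF u] level_eq_length[OF assms(2)]
    by (simp_all add: Gamma_kernel_def field_simps)
qed

lemma Gamma_kernel_incomparable:
  assumes "q \<ge> 1" "\<not> prefix u v" "\<not> prefix v u"
  shows "Gamma_kernel q f u v = 0"
  using assms by (auto simp: Gamma_kernel_def comparable_pairs_def tree_le_iff_prefix indicator_def)

section \<open>An orthonormal Haar basis on each level\<close>

definition words :: "nat \<Rightarrow> nat \<Rightarrow> nat list set" where
  "words q m = {y \<in> tree q. length y = m}"

lemma finite_words: "finite (words q m)"
  unfolding words_def tree_def lists_eq_set
  using finite_lists_length_eq[of "{..<q}" m] by simp

lemma words_0: "words q 0 = {[]}"
  by (auto simp: words_def tree_def)

lemma sum_words_Suc: "(\<Sum>y\<in>words q (Suc m). g y) = (\<Sum>a<q. \<Sum>y\<in>words q m. g (a # y))"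
proof -
  have "(\<Sum>a<q. \<Sum>y\<in>words q m. g (a # y)) = (\<Sum>(a, y)\<in>{..<q} \<times> words q m. g (a # y))"
    by (rule sum.cartesian_product)
  also have "\<dots> = (\<Sum>y\<in>words q (Suc m). g y)"
    by (rule sum.reindex_bij_witness[of _ "\<lambda>y. (hd y, tl y)" "\<lambda>(a, y). a # y"])
       (auto simp: words_def tree_def length_Suc_conv)
  finally show ?thesis by simp
qed

lemma sum_words_rev: "(\<Sum>y\<in>words q m. g (rev y)) = (\<Sum>y\<in>words q m. g y)"
  by (rule sum.reindex_bij_witness[of _ rev rev]) (auto simp: words_def tree_def)

text \<open>
  The unitary discrete Fourier matrix. It serves as an orthogonal decomposition of the functions on the
  \<open>q\<close> children of a vertex into constants (\<open>j = 0\<close>) and functions of sum zero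
  (\<open>j \<noteq> 0\<close>).
\<close>

definition dft :: "nat \<Rightarrow> nat \<Rightarrow> nat \<Rightarrow> complex" where
  "dft q j a = cis (2 * pi * real j * real a / real q) / of_real (sqrt q)"

lemma dft_0: "dft q 0 a = 1 / of_real (sqrt q)"
  by (simp add: dft_def)

lemma dft_sym: "dft q j a = dft q a j"
  by (simp add: dft_def mult_ac)

lemma dft_orthonormal:
  assumes "j < q" "k < q"
  shows "(\<Sum>a<q. dft q j a * cnj (dft q k a)) = (if j = k then 1 else 0)"
proof -
  have q: "q > 0" using assms by simp
  let ?w = "cis (2 * pi * (real j - real k) / real q)"
  have "dft q j a * cnj (dft q k a) = ?w ^ a / of_nat q" for a
  proof -
    have arg: "2 * pi * real j * real a / real q - 2 * pi * real k * real a / real q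
        = real a * (2 * pi * (real j - real k) / real q)"
      using q by (simp add: field_simps)
    have "dft q j a * cnj (dft q k a)
        = cis (2 * pi * real j * real a / real q - 2 * pi * real k * real a / real q)
          / (of_real (sqrt q) * of_real (sqrt q))"
      by (simp add: dft_def cis_cnj cis_mult)
    also note arg
    also have "complex_of_real (sqrt q) * of_real (sqrt q) = of_nat q"
      unfolding of_real_mult[symmetric] by simp
    finally show ?thesis by (simp add: Complex.DeMoivre)
  qed
  then have s: "(\<Sum>a<q. dft q j a * cnj (dft q k a)) = (\<Sum>a<q. ?w ^ a) / of_nat q"
    by (simp add: sum_divide_distrib)
  show ?thesis
  proof (cases "j = k")
    case True
    then show ?thesis using s q by simp
  next
    case False
    \<comment> \<open>The sum is geometric, and its ratio is a nontrivial root of unity of order dividing \<open>q\<close>.\<close>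
    have "?w \<noteq> 1"
    proof
      assume "?w = 1"
      then have "cos (2 * pi * (real j - real k) / real q) = 1"
        by (simp add: complex_eq_iff)
      then obtain n :: int where "2 * pi * (real j - real k) / real q = of_int n * 2 * pi"
        using cos_one_2pi_int by blast
      then have "(2 * pi) * (real j - real k) = (2 * pi) * (of_int n * real q)"
        using q by (simp add: field_simps)
      then have "real j - real k = of_int n * real q" by (subst (asm) mult_cancel_left) simp
      then have "int j - int k = n * int q"
        by (metis of_int_diff of_int_mult of_int_of_nat_eq of_int_eq_iff)
      then have "int j mod int q = int k mod int q"
        by (metis mod_mult_self3 diff_add_cancel add.commute)
      then show False using assms False by simp
    qed
    moreover have "?w ^ q = 1"
    proof -
      have "?w ^ q = cis (2 * pi * of_int (int j - int k))"
        using q by (simp add: Complex.DeMoivre)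
      also have "\<dots> = 1" by (rule cis_multiple_2pi) auto
      finally show ?thesis .
    qed
    ultimately show ?thesis using s False by (simp add: sum_gp_strict)
  qed
qed

text \<open>
  The matrix of the Haar basis, with rows indexed by basis elements and columns by vertices of the same level.
  Words are read from the leaf to the root, the last child label first. As long as the label \<open>j\<close>
  is \<open>0\<close>, the basis function is constant among siblings, that is, obtained by applying
  \<open>S\<close> to the basis function of the parent level. The first nonzero label selects a character of
  sum zero on the children of the vertex that the remaining labels spell out.
\<close>

fun haar :: "nat \<Rightarrow> nat list \<Rightarrow> nat list \<Rightarrow> complex" where
  "haar q [] [] = 1"
| "haar q (j # y) (a # v) = dft q j a * (if j = 0 then haar q y v else if y = v then 1 else 0)"
| "haar q _ _ = 0"

lemma words_SucE:
  assumes "y \<in> words q (Suc m)"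
  obtains j y' where "y = j # y'" "j < q" "y' \<in> words q m"
  using assms by (auto simp: words_def tree_def length_Suc_conv lists_eq_set)

text \<open>
  On level \<open>m + 1\<close> the matrix is built from the Fourier matrix tensored, row by row, with either
  the matrix of level \<open>m\<close> or the identity. Rows with different \<open>j\<close> are orthogonal by
  the Fourier factor alone; for equal \<open>j\<close> the second factor is the same orthonormal matrix on
  both sides.
\<close>

lemma haar_rows_orthonormal:
  assumes "y \<in> words q m" "y' \<in> words q m"
  shows "(\<Sum>v\<in>words q m. haar q y v * cnj (haar q y' v)) = (if y = y' then 1 else 0)"
  using assms
proof (induction m arbitrary: y y')
  case 0
  then show ?case by (simp add: words_0)
next
  case (Suc m)
  obtain j x where y: "y = j # x" "j < q" "x \<in> words q m" using Suc.prems words_SucE by blast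
  obtain k x' where y': "y' = k # x'" "k < q" "x' \<in> words q m" using Suc.prems words_SucE by blast
  let ?P = "\<lambda>j y v. if j = 0 then haar q y v else if y = v then 1 else 0"
  have "(\<Sum>v\<in>words q (Suc m). haar q y v * cnj (haar q y' v))
      = (\<Sum>a<q. \<Sum>v\<in>words q m. (dft q j a * cnj (dft q k a)) * (?P j x v * cnj (?P k x' v)))"
    unfolding sum_words_Suc y y' haar.simps by (intro sum.cong) auto
  also have "\<dots> = (\<Sum>a<q. dft q j a * cnj (dft q k a)) * (\<Sum>v\<in>words q m. ?P j x v * cnj (?P k x' v))"
    unfolding sum_product ..
  also have "\<dots> = (if j = k then \<Sum>v\<in>words q m. ?P j x v * cnj (?P j x' v) else 0)"
    unfolding dft_orthonormal[OF y(2) y'(2)] by simp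
  also have "(\<Sum>v\<in>words q m. ?P j x v * cnj (?P j x' v)) = (if x = x' then 1 else 0)"
  proof (cases "j = 0")
    case True
    then show ?thesis using Suc.IH[OF y(3) y'(3)] by simp
  next
    case False
    then have "(\<Sum>v\<in>words q m. ?P j x v * cnj (?P j x' v))
        = (\<Sum>v\<in>words q m. if v = x then (if x = x' then 1 else 0) else 0)"
      by (intro sum.cong) auto
    then show ?thesis using y(3) finite_words by simp
  qed
  finally show ?case by (auto simp: y y')
qed

lemma haar_columns_orthonormal:
  assumes "v \<in> words q m" "v' \<in> words q m"
  shows "(\<Sum>y\<in>words q m. cnj (haar q y v) * haar q y v') = (if v = v' then 1 else 0)"
  using assms
proof (induction m arbitrary: v v')
  case 0
  then show ?case by (simp add: words_0)
next
  case (Suc m)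
  obtain a x where v: "v = a # x" "a < q" "x \<in> words q m" using Suc.prems words_SucE by blast
  obtain b x' where v': "v' = b # x'" "b < q" "x' \<in> words q m" using Suc.prems words_SucE by blast
  let ?P = "\<lambda>j y v. if j = 0 then haar q y v else if y = v then 1 else 0"
  have P: "(\<Sum>y\<in>words q m. cnj (?P j y x) * ?P j y x') = (if x = x' then 1 else 0)" for j :: nat
  proof (cases "j = 0")
    case True
    then show ?thesis using Suc.IH[OF v(3) v'(3)] by simp
  next
    case False
    then have "(\<Sum>y\<in>words q m. cnj (?P j y x) * ?P j y x')
        = (\<Sum>y\<in>words q m. if y = x then (if x = x' then 1 else 0) else 0)"
      by (intro sum.cong) auto
    then show ?thesis using v(3) finite_words by simp
  qed
  have "(\<Sum>y\<in>words q (Suc m). cnj (haar q y v) * haar q y v')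
      = (\<Sum>j<q. \<Sum>y\<in>words q m. (dft q b j * cnj (dft q a j)) * (cnj (?P j y x) * ?P j y x'))"
    unfolding sum_words_Suc v v' haar.simps dft_sym[of q _ a] dft_sym[of q _ b]
    by (intro sum.cong refl) (simp add: mult_ac)
  also have "\<dots> = (\<Sum>j<q. dft q b j * cnj (dft q a j)) * (if x = x' then 1 else 0)"
    unfolding sum_distrib_left[symmetric] P sum_distrib_right ..
  also have "\<dots> = (if v = v' then 1 else 0)"
    unfolding dft_orthonormal[OF v'(2) v(2)] by (auto simp: v v')
  finally show ?case .
qed

lemma haar_zeros_append:
  "length t = s \<Longrightarrow> haar q (replicate s 0 @ y) (t @ v) = haar q y v / of_real (sqrt q) ^ s"
proof (induction s arbitrary: t)
  case (Suc s)
  then obtain a t' where "t = a # t'" "length t' = s" by (auto simp: length_Suc_conv)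
  with Suc.IH[of t'] show ?case by (simp add: dft_0 field_simps)
qed simp

text \<open>
  Prepending zeros to a row index applies a power of \<open>S\<close> to the basis function. The sums below
  are therefore the matrix entries of that power and of its adjoint in the basis of deltas: they vanish unless
  one vertex lies above the other.
\<close>

lemma haar_correlation:
  assumes "r \<in> words q m" "v \<in> words q m"
  shows "(\<Sum>y\<in>words q m. cnj (haar q (replicate (length t) 0 @ y) (t @ r)) * haar q y v)
    = (if r = v then 1 / of_real (sqrt q) ^ length t else 0)"
    "(\<Sum>y\<in>words q m. cnj (haar q y v) * haar q (replicate (length t) 0 @ y) (t @ r))
    = (if r = v then 1 / of_real (sqrt q) ^ length t else 0)"
  using haar_columns_orthonormal[OF assms] haar_columns_orthonormal[OF assms(2,1)]
  by (auto simp: haar_zeros_append[OF refl] sum_divide_distrib[symmetric])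

section \<open>Operators that respect finite levels\<close>

text \<open>
  The operator with matrix \<open>K\<close> between spaces graded by the level functions \<open>l\<close> and
  \<open>k\<close>, with \<open>K\<close> cut down to its diagonal blocks. For finite levels all sums are
  finite, so that unitarity can be checked blockwise.
\<close>

definition level_op ::
  "('a \<Rightarrow> nat) \<Rightarrow> 'a set \<Rightarrow> ('b \<Rightarrow> nat) \<Rightarrow> 'b set \<Rightarrow> ('b \<Rightarrow> 'a \<Rightarrow> complex) \<Rightarrow> ('a \<Rightarrow> complex) \<Rightarrow> ('b \<Rightarrow> complex)" where
  "level_op l X k Y K x = (\<lambda>i. if i \<in> Y then \<Sum>j\<in>{j\<in>X. l j = k i}. K i j * x j else 0)"

text \<open>
  Orthonormal columns make each block isometric; a finite partial sum of \<open>\<parallel>U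
  x\<parallel>\<^sup>2\<close> meets finitely many levels only.
\<close>

lemma bounded_map_level_op:
  assumes finX: "\<And>m. finite {j\<in>X. l j = m}" and finY: "\<And>m. finite {i\<in>Y. k i = m}"
    and orth: "\<And>j j'. j \<in> X \<Longrightarrow> j' \<in> X \<Longrightarrow> l j = l j' \<Longrightarrow>
      (\<Sum>i\<in>{i\<in>Y. k i = l j}. cnj (K i j) * K i j') = (if j = j' then 1 else 0)"
  shows "bounded_map X Y (level_op l X k Y K)"
proof -
  let ?U = "level_op l X k Y K"
  have level: "(\<Sum>i\<in>{i\<in>Y. k i = m}. (cmod (?U x i))\<^sup>2) = (\<Sum>j\<in>{j\<in>X. l j = m}. (cmod (x j))\<^sup>2)" for x m
  proof -
    let ?X = "{j\<in>X. l j = m}" and ?Y = "{i\<in>Y. k i = m}"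
    have "complex_of_real (\<Sum>i\<in>?Y. (cmod (?U x i))\<^sup>2) = (\<Sum>i\<in>?Y. (\<Sum>j'\<in>?X. K i j' * x j') * cnj (\<Sum>j\<in>?X. K i j * x j))"
      by (simp add: complex_norm_square level_op_def del: of_real_power cnj_sum)
    also have "\<dots> = (\<Sum>i\<in>?Y. \<Sum>j'\<in>?X. \<Sum>j\<in>?X. (x j' * cnj (x j)) * (cnj (K i j) * K i j'))"
      by (simp add: sum_product mult_ac)
    also have "\<dots> = (\<Sum>j'\<in>?X. \<Sum>j\<in>?X. (x j' * cnj (x j)) * (\<Sum>i\<in>?Y. cnj (K i j) * K i j'))"
      by (subst sum.swap, rule sum.cong[OF refl], subst sum.swap) (simp add: sum_distrib_left)
    also have "\<dots> = (\<Sum>j'\<in>?X. \<Sum>j\<in>?X. if j = j' then x j' * cnj (x j') else 0)"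
    proof (intro sum.cong refl)
      fix j' j assume "j' \<in> ?X" "j \<in> ?X"
      then show "(x j' * cnj (x j)) * (\<Sum>i\<in>?Y. cnj (K i j) * K i j') = (if j = j' then x j' * cnj (x j') else 0)"
        using orth[of j j'] by auto
    qed
    also have "\<dots> = complex_of_real (\<Sum>j\<in>?X. (cmod (x j))\<^sup>2)"
      using finX by (simp add: complex_norm_square del: of_real_power)
    finally show ?thesis by (simp only: of_real_eq_iff)
  qed
  have bound: "?U x \<in> ell2 Y \<and> ell2_norm Y (?U x) \<le> 1 * ell2_norm X x" if x: "x \<in> ell2 X" for x
  proof -
    have "(\<Sum>i\<in>G. (cmod (?U x i))\<^sup>2) \<le> (ell2_norm X x)\<^sup>2" if G: "finite G" "G \<subseteq> Y" for G
    proof -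
      have "(\<Sum>i\<in>G. (cmod (?U x i))\<^sup>2) \<le> (\<Sum>i\<in>(\<Union>m\<in>k ` G. {i\<in>Y. k i = m}). (cmod (?U x i))\<^sup>2)"
        using G finY by (intro sum_mono2) auto
      also have "\<dots> = (\<Sum>m\<in>k ` G. \<Sum>i\<in>{i\<in>Y. k i = m}. (cmod (?U x i))\<^sup>2)"
        using G finY by (intro sum.UNION_disjoint) auto
      also have "\<dots> = (\<Sum>m\<in>k ` G. \<Sum>j\<in>{j\<in>X. l j = m}. (cmod (x j))\<^sup>2)"
        by (simp only: level)
      also have "\<dots> = (\<Sum>j\<in>(\<Union>m\<in>k ` G. {j\<in>X. l j = m}). (cmod (x j))\<^sup>2)"
        using G finX by (intro sum.UNION_disjoint[symmetric]) auto
      also have "\<dots> \<le> (ell2_norm X x)\<^sup>2"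
        using G finX by (intro sum_le_ell2_norm x) auto
      finally show ?thesis .
    qed
    moreover have "?U x i = 0" if "i \<notin> Y" for i using that by (simp add: level_op_def)
    ultimately show ?thesis
      using ell2_norm_bound[of Y "?U x" "ell2_norm X x"] ell2_norm_nonneg[of X x] by simp
  qed
  have "?U (\<lambda>i. x i + y i) = (\<lambda>i. ?U x i + ?U y i)" for x y
    by (auto simp: level_op_def fun_eq_iff distrib_left sum.distrib)
  moreover have "?U (\<lambda>i. c * x i) = (\<lambda>i. c * ?U x i)" for c x
    by (auto simp: level_op_def fun_eq_iff mult.left_commute sum_distrib_left)
  ultimately show ?thesis unfolding bounded_map_def using bound by blast
qed

lemma level_op_left_inverse:
  assumes finX: "\<And>m. finite {j\<in>X. l j = m}"
    and orth: "\<And>j j'. j \<in> X \<Longrightarrow> j' \<in> X \<Longrightarrow> l j = l j' \<Longrightarrow>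
      (\<Sum>i\<in>{i\<in>Y. k i = l j}. cnj (K i j) * K i j') = (if j = j' then 1 else 0)"
    and x: "x \<in> ell2 X"
  shows "level_op k Y l X (\<lambda>j i. cnj (K i j)) (level_op l X k Y K x) = x"
proof
  fix j
  show "level_op k Y l X (\<lambda>j i. cnj (K i j)) (level_op l X k Y K x) j = x j"
  proof (cases "j \<in> X")
    case False
    then show ?thesis using ell2_zero_outside[OF x] by (simp add: level_op_def)
  next
    case True
    let ?X = "{j'\<in>X. l j' = l j}" and ?Y = "{i\<in>Y. k i = l j}"
    have "level_op k Y l X (\<lambda>j i. cnj (K i j)) (level_op l X k Y K x) j
        = (\<Sum>i\<in>?Y. \<Sum>j'\<in>?X. (cnj (K i j) * K i j') * x j')"
      using True by (auto simp: level_op_def sum_distrib_left mult.assoc intro!: sum.cong)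
    also have "\<dots> = (\<Sum>j'\<in>?X. (\<Sum>i\<in>?Y. cnj (K i j) * K i j') * x j')"
      by (subst sum.swap) (simp add: sum_distrib_right)
    also have "\<dots> = (\<Sum>j'\<in>?X. if j' = j then x j else 0)"
    proof (intro sum.cong refl)
      fix j' assume "j' \<in> ?X"
      then show "(\<Sum>i\<in>?Y. cnj (K i j) * K i j') * x j' = (if j' = j then x j else 0)"
        using orth[of j j'] True by auto
    qed
    also have "\<dots> = x j" using finX True by simp
    finally show ?thesis .
  qed
qed

section \<open>The Wold decomposition of the tree\<close>

text \<open>
  Labels of an orthonormal basis of the wandering space \<open>ker S\<^sup>*\<close>: the delta at the root
  for the empty word, and otherwise the characters of sum zero, whose leading label is not \<open>0\<close>.
  In a pair \<open>(w, n)\<close> below, \<open>n\<close> is the power of \<open>S\<close> that is applied to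
  the basis element labelled \<open>w\<close>.
\<close>

definition wandering :: "nat \<Rightarrow> nat list set" where
  "wandering q = {w \<in> tree q. w = [] \<or> hd w \<noteq> 0}"

definition wold_level :: "nat list \<times> nat \<Rightarrow> nat" where
  "wold_level p = length (fst p) + snd p"

definition wold_word :: "nat list \<times> nat \<Rightarrow> nat list" where
  "wold_word p = replicate (snd p) 0 @ fst p"

text \<open>
  Each word is uniquely a block of leading zeros followed by a wandering label; on the labels this is the
  decomposition of \<open>\<ell>\<^sup>2(T\<^sub>q)\<close> into the spaces \<open>S\<^sup>n (ker
  S\<^sup>*)\<close>.
\<close>

lemma wold_word_bij:
  assumes "q \<ge> 1"
  shows "bij_betw wold_word {p \<in> wandering q \<times> UNIV. wold_level p = m} (words q m)"
proof (rule bij_betw_byWitness[where f' = "\<lambda>y. (dropWhile ((=) 0) y, length (takeWhile ((=) 0) y))"])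
  have tw: "takeWhile ((=) (0::nat)) (replicate n 0 @ w) = replicate n 0"
    and dw: "dropWhile ((=) (0::nat)) (replicate n 0 @ w) = w" if "w = [] \<or> hd w \<noteq> 0" for n w
    using that by (induction n; cases w; simp)+
  show "\<forall>p\<in>{p \<in> wandering q \<times> UNIV. wold_level p = m}.
      (dropWhile ((=) 0) (wold_word p), length (takeWhile ((=) 0) (wold_word p))) = p"
    by (auto simp: wold_word_def wandering_def tw dw)
  have rep: "replicate (length (takeWhile ((=) 0) y)) 0 @ dropWhile ((=) 0) y = y" for y :: "nat list"
    by (induction y) auto
  then show "\<forall>y\<in>words q m. wold_word (dropWhile ((=) 0) y, length (takeWhile ((=) 0) y)) = y"
    by (simp add: wold_word_def)
  show "wold_word ` {p \<in> wandering q \<times> UNIV. wold_level p = m} \<subseteq> words q m"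
    using assms by (auto simp: wold_word_def wold_level_def wandering_def words_def tree_def)
  show "(\<lambda>y. (dropWhile ((=) 0) y, length (takeWhile ((=) 0) y))) ` words q m
      \<subseteq> {p \<in> wandering q \<times> UNIV. wold_level p = m}"
  proof
    fix p assume "p \<in> (\<lambda>y. (dropWhile ((=) 0) y, length (takeWhile ((=) 0) y))) ` words q m"
    then obtain y where y: "y \<in> words q m" "p = (dropWhile ((=) 0) y, length (takeWhile ((=) 0) y))"
      by blast
    have "dropWhile ((=) 0) y = [] \<or> hd (dropWhile ((=) 0) y) \<noteq> 0"
      using hd_dropWhile[of "(=) 0" y] by metis
    moreover have "set (dropWhile ((=) 0) y) \<subseteq> set y" by (auto dest: set_dropWhileD)
    moreover have "length (dropWhile ((=) 0) y) + length (takeWhile ((=) 0) y) = length y"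
      by (metis add.commute length_append takeWhile_dropWhile_id)
    ultimately show "p \<in> {p \<in> wandering q \<times> UNIV. wold_level p = m}"
      using y by (auto simp: words_def wandering_def wold_level_def tree_def)
  qed
qed

text \<open>
  Vertices are words read from the root, whereas the Haar matrix reads from the leaf.
\<close>

definition wold_kernel :: "nat \<Rightarrow> nat list \<times> nat \<Rightarrow> nat list \<Rightarrow> complex" where
  "wold_kernel q p v = haar q (wold_word p) (rev v)"

text \<open>
  The coordinates of a vector in the Haar basis, grouped by wandering label; unitary by the orthonormality of
  rows and columns on every level.
\<close>

definition wold :: "nat \<Rightarrow> (nat list \<Rightarrow> complex) \<Rightarrow> (nat list \<times> nat \<Rightarrow> complex)" where
  "wold q = level_op length (tree q) wold_level (wandering q \<times> UNIV) (wold_kernel q)"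

definition wold_inv :: "nat \<Rightarrow> (nat list \<times> nat \<Rightarrow> complex) \<Rightarrow> (nat list \<Rightarrow> complex)" where
  "wold_inv q = level_op wold_level (wandering q \<times> UNIV) length (tree q) (\<lambda>v p. cnj (wold_kernel q p v))"

lemma sum_wold_level:
  assumes "q \<ge> 1"
  shows "(\<Sum>p\<in>{p \<in> wandering q \<times> UNIV. wold_level p = m}. g (wold_word p)) = (\<Sum>y\<in>words q m. g y)"
  by (rule sum.reindex_bij_betw[OF wold_word_bij[OF assms]])

lemma wold_kernel_columns:
  assumes "q \<ge> 1" "v \<in> tree q" "v' \<in> tree q" "length v = length v'"
  shows "(\<Sum>p\<in>{p \<in> wandering q \<times> UNIV. wold_level p = length v}.
      cnj (wold_kernel q p v) * wold_kernel q p v') = (if v = v' then 1 else 0)"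
  unfolding wold_kernel_def
    sum_wold_level[OF assms(1), where g = "\<lambda>y. cnj (haar q y (rev v)) * haar q y (rev v')"]
  by (subst haar_columns_orthonormal) (use assms in \<open>auto simp: words_def tree_def\<close>)

lemma wold_kernel_rows:
  assumes "q \<ge> 1" "p \<in> wandering q \<times> UNIV" "p' \<in> wandering q \<times> UNIV" "wold_level p = wold_level p'"
  shows "(\<Sum>v\<in>{v \<in> tree q. length v = wold_level p}.
      cnj (cnj (wold_kernel q p v)) * cnj (wold_kernel q p' v)) = (if p = p' then 1 else 0)"
proof -
  note bij = wold_word_bij[OF assms(1), of "wold_level p"]
  have p: "p \<in> {p' \<in> wandering q \<times> UNIV. wold_level p' = wold_level p}"
    and p': "p' \<in> {p' \<in> wandering q \<times> UNIV. wold_level p' = wold_level p}"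
    using assms by auto
  have "(\<Sum>v\<in>{v \<in> tree q. length v = wold_level p}.
      cnj (cnj (wold_kernel q p v)) * cnj (wold_kernel q p' v))
      = (\<Sum>v\<in>words q (wold_level p). haar q (wold_word p) v * cnj (haar q (wold_word p') v))"
    unfolding wold_kernel_def words_def[symmetric]
    using sum_words_rev[where g = "\<lambda>v. haar q (wold_word p) v * cnj (haar q (wold_word p') v)"] by simp
  also have "\<dots> = (if wold_word p = wold_word p' then 1 else 0)"
    using bij_betwE[OF bij] p p' by (intro haar_rows_orthonormal) auto
  also have "wold_word p = wold_word p' \<longleftrightarrow> p = p'"
    using bij_betw_imp_inj_on[OF bij] p p' by (auto dest: inj_onD)
  finally show ?thesis .
qed

lemma finite_tree_level: "finite {v \<in> tree q. length v = m}"
  using finite_words by (simp add: words_def)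

lemma finite_wold_level:
  assumes "q \<ge> 1"
  shows "finite {p \<in> wandering q \<times> UNIV. wold_level p = m}"
  using bij_betw_finite[OF wold_word_bij[OF assms]] finite_words by blast

lemma
  assumes q: "q \<ge> 1"
  shows bounded_map_wold: "bounded_map (tree q) (wandering q \<times> UNIV) (wold q)"
    and bounded_map_wold_inv: "bounded_map (wandering q \<times> UNIV) (tree q) (wold_inv q)"
    and wold_inv_wold: "x \<in> ell2 (tree q) \<Longrightarrow> wold_inv q (wold q x) = x"
    and wold_wold_inv: "y \<in> ell2 (wandering q \<times> UNIV) \<Longrightarrow> wold q (wold_inv q y) = y"
proof -
  note fin = finite_tree_level finite_wold_level[OF q]
  show "bounded_map (tree q) (wandering q \<times> UNIV) (wold q)"
    unfolding wold_def by (intro bounded_map_level_op fin wold_kernel_columns q)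
  show "bounded_map (wandering q \<times> UNIV) (tree q) (wold_inv q)"
    unfolding wold_inv_def by (intro bounded_map_level_op fin wold_kernel_rows q)
  show "wold_inv q (wold q x) = x" if "x \<in> ell2 (tree q)"
    unfolding wold_def wold_inv_def
    by (intro level_op_left_inverse fin wold_kernel_columns q that)
  show "wold q (wold_inv q y) = y" if "y \<in> ell2 (wandering q \<times> UNIV)"
    using level_op_left_inverse[OF fin(2) wold_kernel_rows[OF q] that]
    unfolding wold_def wold_inv_def complex_cnj_cnj .
qed

lemma wold_delta:
  assumes "v \<in> tree q"
  shows "wold q (delta v) p =
    (if fst p \<in> wandering q \<and> wold_level p = length v then wold_kernel q p v else 0)"
proof -
  have "(\<Sum>j\<in>{j \<in> tree q. length j = wold_level p}. wold_kernel q p j * delta v j)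
      = (\<Sum>j\<in>{j \<in> tree q. length j = wold_level p}. if j = v then wold_kernel q p v else 0)"
    by (intro sum.cong) (auto simp: delta_def)
  then show ?thesis
    using assms finite_tree_level by (auto simp: wold_def level_op_def mem_Times_iff)
qed

lemma ampliation_wold_delta:
  assumes "v \<in> tree q" "w \<in> wandering q"
  shows "ampliation (wandering q) (Toeplitz_op f) (wold q (delta v)) (w, n) =
    (if length w \<le> length v
     then fourier_coeff f (int (length w + n) - int (length v)) * wold_kernel q (w, length v - length w) v
     else 0)"
proof -
  have "ampliation (wandering q) (Toeplitz_op f) (wold q (delta v)) (w, n)
      = (\<Sum>\<^sub>\<infinity>l. fourier_coeff f (int n - int l) * wold q (delta v) (w, l))"
    using assms(2) by (simp add: ampliation_def Toeplitz_op_def kernel_op_def)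
  also have "\<dots> = (\<Sum>\<^sub>\<infinity>l\<in>{l. length w + l = length v}.
      fourier_coeff f (int n - int l) * wold_kernel q (w, l) v)"
    by (rule infsum_cong_neutral) (use assms in \<open>auto simp: wold_delta wold_level_def\<close>)
  also have "{l. length w + l = length v} = (if length w \<le> length v then {length v - length w} else {})"
    by auto
  finally show ?thesis by (simp add: algebra_simps)
qed

text \<open>
  Conjugating \<open>T(f)\<close> on each copy pairs the basis functions \<open>S\<^sup>n w\<close> and
  \<open>S\<^sup>n\<^sup>' w\<close> of a common label \<open>w\<close> with weight \<open>f^(n - n')\<close>.
  If the first is supported on the level of \<open>u\<close> and the second on that of \<open>v\<close>, then
  \<open>n - n' = |u| - |v|\<close> for every \<open>w\<close>. So the Fourier coefficient leaves the sum, and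
  what remains is the Haar correlation of the two vertices, an entry of a power of \<open>S\<close> or of
  \<open>S\<^sup>*\<close>.
\<close>

lemma wold_conjugate_kernel:
  assumes q: "q \<ge> 1" and u: "u \<in> tree q" and v: "v \<in> tree q"
  shows "wold_inv q (ampliation (wandering q) (Toeplitz_op f) (wold q (delta v))) u = Gamma_kernel q f u v"
proof -
  let ?L = "\<lambda>m. {p \<in> wandering q \<times> UNIV. wold_level p = m}"
  define S where "S = (\<Sum>p\<in>?L (length u). if length (fst p) \<le> length v
      then cnj (wold_kernel q p u) * wold_kernel q (fst p, length v - length (fst p)) v else 0)"
  have "wold_inv q (ampliation (wandering q) (Toeplitz_op f) (wold q (delta v))) u
      = (\<Sum>p\<in>?L (length u). cnj (wold_kernel q p u) *
          ampliation (wandering q) (Toeplitz_op f) (wold q (delta v)) p)"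
    using u by (simp add: wold_inv_def level_op_def)
  also have "\<dots> = fourier_coeff f (int (length u) - int (length v)) * S"
    unfolding S_def sum_distrib_left
    by (intro sum.cong refl) (auto simp: ampliation_wold_delta[OF v] wold_level_def)
  finally have eq: "wold_inv q (ampliation (wandering q) (Toeplitz_op f) (wold q (delta v))) u
      = fourier_coeff f (int (length u) - int (length v)) * S" .
  have shift: "wold_word (w, n + s) = replicate s 0 @ wold_word (w, n)" for w n s
    by (simp add: wold_word_def add.commute[of n s] replicate_add)
  have word: "rev z \<in> words q (length z)" if "z \<in> tree q" for z
    using that by (auto simp: words_def tree_def)
  show ?thesis
  proof (cases "length v \<le> length u")
    case True
    define s where "s = length u - length v"
    define b t where "b = take (length v) u" and "t = drop (length v) u"
    have bt: "u = b @ t" "length b = length v" "length t = s"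
      using True by (auto simp: b_def t_def s_def)
    have b: "b \<in> tree q" using u bt by (simp add: tree_append)
    have "S = (\<Sum>p\<in>{p \<in> ?L (length u). length (fst p) \<le> length v}.
        cnj (wold_kernel q p u) * wold_kernel q (fst p, length v - length (fst p)) v)"
      unfolding S_def by (rule sum.inter_filter[symmetric, OF finite_wold_level[OF q]])
    also have "\<dots> = (\<Sum>p\<in>?L (length v).
        cnj (haar q (replicate s 0 @ wold_word p) (rev u)) * haar q (wold_word p) (rev v))"
    \<comment> \<open>The label \<open>w\<close> is kept; the power of \<open>S\<close> drops by \<open>s\<close>, from the level of \<open>u\<close> to that of \<open>v\<close>.\<close>
    proof (rule sum.reindex_bij_witness[where i = "\<lambda>(w, n). (w, n + s)"
          and j = "\<lambda>(w, n). (w, length v - length w)"], goal_cases)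
      case (5 p)
      obtain w n where p: "p = (w, n)" by fastforce
      have "n = (length v - length w) + s" using 5 p True by (auto simp: wold_level_def s_def)
      then have "wold_word p = replicate s 0 @ wold_word (w, length v - length w)"
        using p shift by metis
      then show ?case using p by (simp add: wold_kernel_def)
    qed (use True in \<open>auto simp: wold_level_def s_def\<close>)
    also have "\<dots> = (\<Sum>y\<in>words q (length v). cnj (haar q (replicate s 0 @ y) (rev u)) * haar q y (rev v))"
      by (rule sum_wold_level[OF q])
    also have "\<dots> = (if b = v then 1 / of_real (sqrt q) ^ s else 0)"
      using haar_correlation(1)[of "rev b" q "length v" "rev v" "rev t"] word[OF b] word[OF v] bt
      by simp
    finally have S: "S = (if b = v then 1 / of_real (sqrt q) ^ s else 0)" .
    show ?thesis
    proof (cases "b = v")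
      case True
      then show ?thesis using eq S bt Gamma_kernel_append(1)[OF q, of v t f] u by simp
    next
      case False
      then have "\<not> prefix v u" "\<not> prefix u v"
        using bt by (auto simp: prefix_def)
      then show ?thesis using eq S False Gamma_kernel_incomparable[OF q] by simp
    qed
  next
    case False
    define s where "s = length v - length u"
    define b t where "b = take (length u) v" and "t = drop (length u) v"
    have bt: "v = b @ t" "length b = length u" "length t = s"
      using False by (auto simp: b_def t_def s_def)
    have b: "b \<in> tree q" using v bt by (simp add: tree_append)
    have "S = (\<Sum>p\<in>?L (length u).
        cnj (haar q (wold_word p) (rev u)) * haar q (replicate s 0 @ wold_word p) (rev v))"
      unfolding S_def
    proof (intro sum.cong refl)
      fix p assume p: "p \<in> ?L (length u)"
      obtain w n where wn: "p = (w, n)" by fastforce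
      have "length v - length w = n + s" "length w \<le> length v"
        using p wn False by (auto simp: wold_level_def s_def)
      then show "(if length (fst p) \<le> length v
          then cnj (wold_kernel q p u) * wold_kernel q (fst p, length v - length (fst p)) v else 0)
        = cnj (haar q (wold_word p) (rev u)) * haar q (replicate s 0 @ wold_word p) (rev v)"
        using wn shift by (simp add: wold_kernel_def)
    qed
    also have "\<dots> = (\<Sum>y\<in>words q (length u). cnj (haar q y (rev u)) * haar q (replicate s 0 @ y) (rev v))"
      by (rule sum_wold_level[OF q])
    also have "\<dots> = (if b = u then 1 / of_real (sqrt q) ^ s else 0)"
      using haar_correlation(2)[of "rev b" q "length u" "rev u" "rev t"] word[OF b] word[OF u] bt
      by simp
    finally have S: "S = (if b = u then 1 / of_real (sqrt q) ^ s else 0)" .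
    show ?thesis
    proof (cases "b = u")
      case True
      then show ?thesis using eq S bt Gamma_kernel_append(2)[OF q, of u t f] v by simp
    next
      case False
      then have "\<not> prefix u v" "\<not> prefix v u"
        using bt by (auto simp: prefix_def)
      then show ?thesis using eq S False Gamma_kernel_incomparable[OF q] by simp
    qed
  qed
qed

text \<open>
  The right-hand side is bounded, hence given by its kernel, and that kernel has just been computed.
\<close>

lemma Gamma_op_eq_wold_conjugate:
  assumes q: "q \<ge> 1" and f: "f \<in> Linf_circle" and x: "x \<in> ell2 (tree q)"
  shows "Gamma_op q f x = wold_inv q (ampliation (wandering q) (Toeplitz_op f) (wold q x))"
proof -
  let ?M = "\<lambda>x. wold_inv q (ampliation (wandering q) (Toeplitz_op f) (wold q x))"
  have M: "bounded_op (tree q) ?M"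
    unfolding bounded_op_iff_bounded_map
    by (intro bounded_map_compose[OF bounded_map_compose[OF bounded_map_wold[OF q]
        bounded_map_ampliation[OF bounded_map_Toeplitz_op[OF f]]] bounded_map_wold_inv[OF q]])
  have "?M x = kernel_op (tree q) (\<lambda>u v. ell2_inner (tree q) (?M (delta v)) (delta u)) x"
    by (rule bounded_op_eq_kernel_op[OF M x])
  also have "\<dots> = Gamma_op q f x"
    unfolding Gamma_op_def kernel_op_def
    by (auto simp: fun_eq_iff ell2_inner_delta wold_conjugate_kernel[OF q] intro!: infsum_cong)
  finally show ?thesis by simp
qed

theorem spec_Gamma_op:
  assumes q: "q \<ge> 1" and f: "f \<in> Linf_circle"
  shows "spec (tree q) (Gamma_op q f) = spec UNIV (Toeplitz_op f)"
proof -
  let ?W = "wandering q"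
  let ?A = "ampliation ?W (Toeplitz_op f)"
  note T = bounded_map_Toeplitz_op[OF f]
  note U = bounded_map_wold[OF q] and V = bounded_map_wold_inv[OF q]
  note A = bounded_map_ampliation[OF T, of ?W]
  note G = Gamma_op_eq_wold_conjugate[OF q f]
  have Gc: "Gamma_op q f x \<in> ell2 (tree q)" if "x \<in> ell2 (tree q)" for x
    unfolding G[OF that] by (intro bounded_map_closed[OF V] bounded_map_closed[OF A] bounded_map_closed[OF U] that)
  have UG: "wold q (Gamma_op q f x) = ?A (wold q x)" if "x \<in> ell2 (tree q)" for x
    unfolding G[OF that]
    by (intro wold_wold_inv[OF q] bounded_map_closed[OF A] bounded_map_closed[OF U] that)
  have VA: "wold_inv q (?A y) = Gamma_op q f (wold_inv q y)" if "y \<in> ell2 (?W \<times> UNIV)" for y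
    using G[OF bounded_map_closed[OF V that]] wold_wold_inv[OF q that] by simp
  have "spec (tree q) (Gamma_op q f) = spec (?W \<times> UNIV) ?A"
  proof
    show "spec (tree q) (Gamma_op q f) \<subseteq> spec (?W \<times> UNIV) ?A"
      by (rule spec_subset_retract[OF U V])
         (use wold_inv_wold[OF q] Gc bounded_map_closed[OF A] UG VA in auto)
    show "spec (?W \<times> UNIV) ?A \<subseteq> spec (tree q) (Gamma_op q f)"
      by (rule spec_subset_retract[OF V U])
         (use wold_wold_inv[OF q] Gc bounded_map_closed[OF A] UG VA in auto)
  qed
  also have "\<dots> = spec UNIV (Toeplitz_op f)"
    by (rule spec_ampliation[OF T]) (auto simp: wandering_def tree_def)
  finally show ?thesis .
qed

theorem corollary1p7:
  fixes q :: nat and f :: "complex \<Rightarrow> complex"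
  assumes "q \<ge> 2" and "f \<in> Linf_circle"
  shows "spec (tree q) (Gamma_op q f) = spec (tree 1) (Gamma_op 1 f) \<and>
         spec (tree 1) (Gamma_op 1 f) = spec (UNIV :: nat set) (Toeplitz_op f)"
  using spec_Gamma_op[of q f] spec_Gamma_op[of 1 f] assms by simp

end
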